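(* Let $K$ be a field. If $X\subset\mathbb{P}^r_K$ is a reduced hypersurface with distinct irreducible components $X_i$, then $$\mathfrak{C}'_X=\sum_i\mathfrak{C}'_{X_i}\prod_{j\ne i}I_{X_j}.$$
   Context: Let $S=K[x_0,\dots,x_r]$. For a subscheme $Y\subset\mathbb{P}^r_K$, $I_Y\subset S$ is its saturated homogeneous ideal. For $Y$ reduced with homogeneous coordinate ring $A=S/I_Y$ and normalization $\overline{A}$ (integral closure of $A$ in its total ring of quotients), the conductor ideal is $\mathfrak{C}'_Y:=\operatorname{ann}_S(\overline{A}/A)\subset S$ (so $\mathfrak{C}'_Y=S$ if $A$ is normal). *)

theory Defs
  imports
    "HOL-Algebra.Ideal_Product"
    "HOL-Algebra.QuotRing"
    "HOL-Algebra.Polynomials"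
    "HOL-Library.Poly_Mapping"
    "HOL-Analysis.Abstract_Topology"
begin

section \<open>The graded ring \<open>S = K[x\<^sub>0, \<dots>, x\<^sub>r]\<close>\<close>

text \<open>
  A monomial is a finitely supported exponent function, and a polynomial a finitely supported
  function from monomials to the field \<open>K\<close>, which is the type \<open>'k\<close>.  The type has a variable for
  every natural number; \<open>S\<close> consists of the polynomials in the variables \<open>x\<^sub>0, \<dots>, x\<^sub>r\<close> only.
\<close>

type_synonym 'k poly_nat = "(nat \<Rightarrow>\<^sub>0 nat) \<Rightarrow>\<^sub>0 'k"

definition coord_ring :: "nat \<Rightarrow> ('k::field) poly_nat ring" where
  "coord_ring r =
     \<lparr>carrier = {f. \<forall>m \<in> Poly_Mapping.keys f. Poly_Mapping.keys m \<subseteq> {..r}},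
      monoid.mult = (*), one = 1, zero = 0, add = (+)\<rparr>"

definition coord :: "nat \<Rightarrow> ('k::field) poly_nat" where
  "coord i = Poly_Mapping.single (Poly_Mapping.single i 1) 1"

definition total_degree :: "(nat \<Rightarrow>\<^sub>0 nat) \<Rightarrow> nat" where
  "total_degree m = (\<Sum>i \<in> Poly_Mapping.keys m. Poly_Mapping.lookup m i)"

definition forms :: "nat \<Rightarrow> nat \<Rightarrow> ('k::field) poly_nat set" where
  "forms r d = {f \<in> carrier (coord_ring r). \<forall>m \<in> Poly_Mapping.keys f. total_degree m = d}"

definition all_forms :: "nat \<Rightarrow> ('k::field) poly_nat set" where
  "all_forms r = (\<Union>d. forms r d)"

definition homogeneous_ideal :: "nat \<Rightarrow> ('k::field) poly_nat set \<Rightarrow> bool" where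
  "homogeneous_ideal r I \<longleftrightarrow>
     ideal I (coord_ring r) \<and> I = Idl\<^bsub>coord_ring r\<^esub> (I \<inter> all_forms r)"

definition saturated :: "nat \<Rightarrow> ('k::field) poly_nat set \<Rightarrow> bool" where
  "saturated r I \<longleftrightarrow>
     (\<forall>f \<in> carrier (coord_ring r). (\<forall>i\<le>r. \<exists>m. coord i ^ m * f \<in> I) \<longrightarrow> f \<in> I)"


section \<open>Projective space and its closed subschemes\<close>

definition proj_space :: "nat \<Rightarrow> ('k::field) poly_nat set set" where
  "proj_space r =
     {P. primeideal P (coord_ring r) \<and> homogeneous_ideal r P \<and> (\<exists>i\<le>r. coord i \<notin> P)}"

definition zero_locus :: "nat \<Rightarrow> ('k::field) poly_nat set \<Rightarrow> 'k poly_nat set set" where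
  "zero_locus r E = {P \<in> proj_space r. E \<subseteq> P}"

definition zariski_topology :: "nat \<Rightarrow> ('k::field) poly_nat set topology" where
  "zariski_topology r =
     topology (\<lambda>U. \<exists>E \<subseteq> all_forms r. U = proj_space r - zero_locus r E)"

text \<open>
  Closed subschemes \<open>Y\<close> of projective \<open>r\<close>-space correspond bijectively to saturated homogeneous
  ideals \<open>I\<^sub>Y\<close> of \<open>S\<close>.  Throughout, \<open>Y\<close> is represented by \<open>I\<^sub>Y\<close>; its underlying space is
  \<open>zero_locus r I\<^sub>Y\<close>.
\<close>

definition closed_subscheme :: "nat \<Rightarrow> ('k::field) poly_nat set \<Rightarrow> bool" where
  "closed_subscheme r I \<longleftrightarrow> homogeneous_ideal r I \<and> saturated r I"

text \<open>
  Let \<open>f\<close> be a form of degree \<open>d\<close>.  The function \<open>f / x\<^sub>i\<^sup>d\<close> on the standard affine open set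
  \<open>x\<^sub>i \<noteq> 0\<close> restricts to \<open>0\<close> on \<open>Y\<close> iff \<open>x\<^sub>i\<^sup>m f \<in> I\<^sub>Y\<close> for some \<open>m\<close>.  The definition therefore
  says that the coordinate rings of the affine open subschemes \<open>Y \<inter> {x\<^sub>i \<noteq> 0}\<close>, which cover \<open>Y\<close>,
  have no nilpotent elements other than \<open>0\<close>.
\<close>

definition reduced_subscheme :: "nat \<Rightarrow> ('k::field) poly_nat set \<Rightarrow> bool" where
  "reduced_subscheme r I \<longleftrightarrow> closed_subscheme r I \<and>
     (\<forall>i\<le>r. \<forall>f \<in> all_forms r. \<forall>n.
        (\<exists>m. coord i ^ m * f ^ n \<in> I) \<longrightarrow> (\<exists>m. coord i ^ m * f \<in> I))"

text \<open>
  For \<open>r = 0\<close> there are no hypersurfaces: a power of \<open>x\<^sub>0\<close> generates an ideal that is not saturated.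
\<close>

definition hypersurface :: "nat \<Rightarrow> ('k::field) poly_nat set \<Rightarrow> bool" where
  "hypersurface r I \<longleftrightarrow> closed_subscheme r I \<and>
     (\<exists>d \<ge> 1. \<exists>F \<in> forms r d. F \<noteq> 0 \<and> I = PIdl\<^bsub>coord_ring r\<^esub> F)"

definition irreducible_in :: "'a topology \<Rightarrow> 'a set \<Rightarrow> bool" where
  "irreducible_in T Z \<longleftrightarrow> Z \<subseteq> topspace T \<and> Z \<noteq> {} \<and>
     (\<forall>C D. closedin T C \<and> closedin T D \<and> Z \<subseteq> C \<union> D \<longrightarrow> Z \<subseteq> C \<or> Z \<subseteq> D)"

definition irreducible_components :: "'a topology \<Rightarrow> 'a set set" where
  "irreducible_components T =
     {Z. irreducible_in T Z \<and> (\<forall>W. irreducible_in T W \<and> Z \<subseteq> W \<longrightarrow> W = Z)}"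

text \<open>The ideal of a set \<open>Z\<close> of points; for closed \<open>Z\<close> it defines the reduced structure on \<open>Z\<close>.\<close>

definition vanishing_ideal :: "nat \<Rightarrow> ('k::field) poly_nat set set \<Rightarrow> 'k poly_nat set" where
  "vanishing_ideal r Z = {f \<in> carrier (coord_ring r). \<forall>P \<in> Z. f \<in> P}"

definition component_subschemes ::
    "nat \<Rightarrow> ('k::field) poly_nat set \<Rightarrow> 'k poly_nat set set" where
  "component_subschemes r I = vanishing_ideal r `
     irreducible_components (subtopology (zariski_topology r) (zero_locus r I))"


section \<open>Total ring of quotients, normalization and conductor\<close>

definition nonzerodivisors :: "('a, 'b) ring_scheme \<Rightarrow> 'a set" where
  "nonzerodivisors R =
     {s \<in> carrier R. \<forall>a \<in> carrier R. s \<otimes>\<^bsub>R\<^esub> a = \<zero>\<^bsub>R\<^esub> \<longrightarrow> a = \<zero>\<^bsub>R\<^esub>}"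

definition fraction_rel :: "('a, 'b) ring_scheme \<Rightarrow> (('a \<times> 'a) \<times> ('a \<times> 'a)) set" where
  "fraction_rel R = {((a, s), (b, t)).
     a \<in> carrier R \<and> s \<in> nonzerodivisors R \<and> b \<in> carrier R \<and> t \<in> nonzerodivisors R \<and>
     a \<otimes>\<^bsub>R\<^esub> t = b \<otimes>\<^bsub>R\<^esub> s}"

definition fraction :: "('a, 'b) ring_scheme \<Rightarrow> 'a \<Rightarrow> 'a \<Rightarrow> ('a \<times> 'a) set" where
  "fraction R a s = fraction_rel R `` {(a, s)}"

definition total_quotient_ring :: "('a, 'b) ring_scheme \<Rightarrow> ('a \<times> 'a) set ring" where
  "total_quotient_ring R =
     \<lparr>carrier = (carrier R \<times> nonzerodivisors R) // fraction_rel R,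
      monoid.mult = (\<lambda>x y. \<Union>(a, s) \<in> x. \<Union>(b, t) \<in> y. fraction R (a \<otimes>\<^bsub>R\<^esub> b) (s \<otimes>\<^bsub>R\<^esub> t)),
      one = fraction R \<one>\<^bsub>R\<^esub> \<one>\<^bsub>R\<^esub>,
      zero = fraction R \<zero>\<^bsub>R\<^esub> \<one>\<^bsub>R\<^esub>,
      add = (\<lambda>x y. \<Union>(a, s) \<in> x. \<Union>(b, t) \<in> y.
               fraction R (a \<otimes>\<^bsub>R\<^esub> t \<oplus>\<^bsub>R\<^esub> b \<otimes>\<^bsub>R\<^esub> s) (s \<otimes>\<^bsub>R\<^esub> t))\<rparr>"

definition to_quotients :: "('a, 'b) ring_scheme \<Rightarrow> 'a \<Rightarrow> ('a \<times> 'a) set" where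
  "to_quotients R a = fraction R a \<one>\<^bsub>R\<^esub>"

text \<open>Polynomials are coefficient lists with the leading coefficient first.\<close>

definition integral_over :: "('a, 'b) ring_scheme \<Rightarrow> 'a set \<Rightarrow> 'a \<Rightarrow> bool" where
  "integral_over Q B x \<longleftrightarrow>
     (\<exists>p. p \<noteq> [] \<and> set p \<subseteq> B \<and> hd p = \<one>\<^bsub>Q\<^esub> \<and> ring.eval Q p x = \<zero>\<^bsub>Q\<^esub>)"

definition normalization :: "('a, 'b) ring_scheme \<Rightarrow> ('a \<times> 'a) set set" where
  "normalization R = {x \<in> carrier (total_quotient_ring R).
     integral_over (total_quotient_ring R) (to_quotients R ` carrier R) x}"

text \<open>
  With \<open>A = S / I\<close> and \<open>B\<close> the normalization of \<open>A\<close>, an element \<open>s\<close> of \<open>S\<close> annihilates the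
  \<open>S\<close>-module \<open>B / A\<close> iff \<open>s b \<in> A\<close> for all \<open>b \<in> B\<close>, where \<open>s\<close> acts on \<open>B\<close> through its residue
  class in \<open>A\<close>, and \<open>A\<close> is identified with its image in its total ring of quotients.
\<close>

definition conductor :: "nat \<Rightarrow> ('k::field) poly_nat set \<Rightarrow> 'k poly_nat set" where
  "conductor r I =
     (let A = coord_ring r Quot I
      in {s \<in> carrier (coord_ring r). \<forall>b \<in> normalization A.
            to_quotients A (I +>\<^bsub>coord_ring r\<^esub> s) \<otimes>\<^bsub>total_quotient_ring A\<^esub> b
              \<in> to_quotients A ` carrier A})"


section \<open>Well-definedness\<close>

lemma carrier_coord_ring_mult:
  assumes "f \<in> carrier (coord_ring r)" "g \<in> carrier (coord_ring r)"
  shows "f * g \<in> carrier (coord_ring r)"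
proof -
  have "Poly_Mapping.keys m \<subseteq> {..r}" if m: "m \<in> Poly_Mapping.keys (f * g)" for m
  proof -
    obtain a b where "a \<in> Poly_Mapping.keys f" "b \<in> Poly_Mapping.keys g" "m = a + b"
      using m keys_mult[of f g] by blast
    moreover have "Poly_Mapping.keys (a + b) \<subseteq> Poly_Mapping.keys a \<union> Poly_Mapping.keys b"
      by (rule keys_add)
    ultimately show ?thesis using assms by (fastforce simp: coord_ring_def)
  qed
  then show ?thesis by (simp add: coord_ring_def)
qed

lemma cring_coord_ring: "cring (coord_ring r :: ('k::field) poly_nat ring)"
proof (rule cringI)
  show "abelian_group (coord_ring r :: 'k poly_nat ring)"
  proof (rule abelian_groupI)
    fix f g :: "'k poly_nat"
    assume f: "f \<in> carrier (coord_ring r)" and g: "g \<in> carrier (coord_ring r)"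
    show "f \<oplus>\<^bsub>coord_ring r\<^esub> g \<in> carrier (coord_ring r)"
      using f g keys_add[of f g] by (fastforce simp: coord_ring_def)
    have "- f \<in> carrier (coord_ring r)"
      using f by (simp add: coord_ring_def)
    then show "\<exists>h \<in> carrier (coord_ring r). h \<oplus>\<^bsub>coord_ring r\<^esub> f = \<zero>\<^bsub>coord_ring r\<^esub>"
      by (intro bexI[of _ "- f"]) (simp_all add: coord_ring_def)
  qed (simp_all add: coord_ring_def ac_simps)
  show "comm_monoid (coord_ring r :: 'k poly_nat ring)"
  proof (rule comm_monoidI)
    fix f g :: "'k poly_nat"
    assume "f \<in> carrier (coord_ring r)" "g \<in> carrier (coord_ring r)"
    then show "f \<otimes>\<^bsub>coord_ring r\<^esub> g \<in> carrier (coord_ring r)"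
      using carrier_coord_ring_mult by (simp add: coord_ring_def)
  qed (simp_all add: coord_ring_def ac_simps)
qed (simp add: coord_ring_def distrib_right)

lemma total_degree_add: "total_degree (a + b) = total_degree a + total_degree b"
proof -
  have *: "total_degree m = (\<Sum>i \<in> V. Poly_Mapping.lookup m i)"
    if "finite V" "Poly_Mapping.keys m \<subseteq> V" for m and V :: "nat set"
    unfolding total_degree_def using that
    by (intro sum.mono_neutral_left) (auto simp: in_keys_iff)
  let ?V = "Poly_Mapping.keys a \<union> Poly_Mapping.keys b"
  have "total_degree (a + b) = (\<Sum>i \<in> ?V. Poly_Mapping.lookup (a + b) i)"
    by (rule *) (simp_all add: keys_add)
  also have "\<dots> = total_degree a + total_degree b"
    by (simp add: lookup_add sum.distrib *[of ?V a] *[of ?V b])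
  finally show ?thesis .
qed

lemma all_forms_mult:
  assumes "f \<in> all_forms r" "g \<in> all_forms r"
  shows "f * g \<in> all_forms r"
proof -
  obtain d e where f: "f \<in> forms r d" and g: "g \<in> forms r e"
    using assms by (auto simp: all_forms_def)
  have "total_degree m = d + e" if m: "m \<in> Poly_Mapping.keys (f * g)" for m
  proof -
    obtain a b where "a \<in> Poly_Mapping.keys f" "b \<in> Poly_Mapping.keys g" "m = a + b"
      using m keys_mult[of f g] by blast
    then show ?thesis using f g by (simp add: forms_def total_degree_add)
  qed
  moreover have "f * g \<in> carrier (coord_ring r)"
    using f g by (simp add: forms_def carrier_coord_ring_mult)
  ultimately have "f * g \<in> forms r (d + e)" by (simp add: forms_def)
  then show ?thesis by (auto simp: all_forms_def)
qed

lemma zero_locus_Un: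
  assumes "E \<subseteq> all_forms r" "F \<subseteq> all_forms r"
  shows "zero_locus r E \<union> zero_locus r F = zero_locus r {f * g |f g. f \<in> E \<and> g \<in> F}"
proof
  show "zero_locus r E \<union> zero_locus r F \<subseteq> zero_locus r {f * g |f g. f \<in> E \<and> g \<in> F}"
  proof
    fix P assume P: "P \<in> zero_locus r E \<union> zero_locus r F"
    then have "ideal P (coord_ring r)"
      by (auto simp: zero_locus_def proj_space_def homogeneous_ideal_def)
    then interpret ideal P "coord_ring r" .
    have "f * g \<in> P" if "f \<in> E" "g \<in> F" for f g
    proof -
      have "f \<in> carrier (coord_ring r)" "g \<in> carrier (coord_ring r)"
        using assms that by (auto simp: all_forms_def forms_def)
      moreover have "f \<in> P \<or> g \<in> P" using P that by (auto simp: zero_locus_def)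
      ultimately have "f \<otimes>\<^bsub>coord_ring r\<^esub> g \<in> P"
        using I_l_closed[of g f] I_r_closed[of f g] by blast
      then show ?thesis by (simp add: coord_ring_def)
    qed
    then show "P \<in> zero_locus r {f * g |f g. f \<in> E \<and> g \<in> F}"
      using P by (auto simp: zero_locus_def)
  qed
  show "zero_locus r {f * g |f g. f \<in> E \<and> g \<in> F} \<subseteq> zero_locus r E \<union> zero_locus r F"
  proof
    fix P assume P: "P \<in> zero_locus r {f * g |f g. f \<in> E \<and> g \<in> F}"
    then have "primeideal P (coord_ring r)"
      by (auto simp: zero_locus_def proj_space_def)
    then interpret primeideal P "coord_ring r" .
    have "F \<subseteq> P" if "f \<in> E" "f \<notin> P" for f
    proof
      fix g assume "g \<in> F"
      have "f \<in> carrier (coord_ring r)" "g \<in> carrier (coord_ring r)"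
        using assms that \<open>g \<in> F\<close> by (auto simp: all_forms_def forms_def)
      moreover have "f \<otimes>\<^bsub>coord_ring r\<^esub> g \<in> P"
        using P that \<open>g \<in> F\<close> by (auto simp: zero_locus_def coord_ring_def)
      ultimately show "g \<in> P" using I_prime that by blast
    qed
    then show "P \<in> zero_locus r E \<union> zero_locus r F"
      using P by (auto simp: zero_locus_def)
  qed
qed

lemma istopology_zariski:
  "istopology (\<lambda>U. \<exists>E \<subseteq> all_forms r.
     U = (proj_space r :: ('k::field) poly_nat set set) - zero_locus r E)"
  unfolding istopology_def
proof (intro conjI allI impI)
  fix U V :: "'k poly_nat set set"
  assume "\<exists>E \<subseteq> all_forms r. U = proj_space r - zero_locus r E"
    and "\<exists>E \<subseteq> all_forms r. V = proj_space r - zero_locus r E"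
  then obtain E F where E: "E \<subseteq> all_forms r" "U = proj_space r - zero_locus r E"
    and F: "F \<subseteq> all_forms r" "V = proj_space r - zero_locus r F" by blast
  have "U \<inter> V = proj_space r - zero_locus r {f * g |f g. f \<in> E \<and> g \<in> F}"
    using E F zero_locus_Un[of E r F] by blast
  moreover have "{f * g |f g. f \<in> E \<and> g \<in> F} \<subseteq> all_forms r"
    using E F all_forms_mult by blast
  ultimately show "\<exists>E \<subseteq> all_forms r. U \<inter> V = proj_space r - zero_locus r E" by blast
next
  fix \<U> :: "'k poly_nat set set set"
  assume "\<forall>U \<in> \<U>. \<exists>E \<subseteq> all_forms r. U = proj_space r - zero_locus r E"
  then obtain E where E: "\<And>U. U \<in> \<U> \<Longrightarrow> E U \<subseteq> all_forms r \<and> U = proj_space r - zero_locus r (E U)"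
    using bchoice[of \<U>] by metis
  have "\<Union>\<U> = (\<Union>U\<in>\<U>. proj_space r - zero_locus r (E U))"
    using E by auto
  also have "\<dots> = proj_space r - zero_locus r (\<Union>U\<in>\<U>. E U)"
    by (auto simp: zero_locus_def)
  finally show "\<exists>E \<subseteq> all_forms r. \<Union>\<U> = proj_space r - zero_locus r E"
    using E by (intro exI[of _ "\<Union>U\<in>\<U>. E U"]) auto
qed

lemma openin_zariski:
  "openin (zariski_topology r) U \<longleftrightarrow>
     (\<exists>E \<subseteq> all_forms r. U = proj_space r - zero_locus r E)"
  by (simp add: zariski_topology_def topology_inverse'[OF istopology_zariski])

lemma topspace_zariski: "topspace (zariski_topology r) = (proj_space r :: ('k::field) poly_nat set set)"
proof -
  have "1 \<in> (forms r 0 :: 'k poly_nat set)"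
    by (simp add: forms_def coord_ring_def total_degree_def)
  then have one: "{1} \<subseteq> (all_forms r :: 'k poly_nat set)" by (auto simp: all_forms_def)
  have "zero_locus r {1 :: 'k poly_nat} = {}"
  proof (rule equals0I)
    fix P :: "'k poly_nat set" assume "P \<in> zero_locus r {1}"
    then have P: "primeideal P (coord_ring r)" "1 \<in> P"
      by (auto simp: zero_locus_def proj_space_def)
    interpret primeideal P "coord_ring r" by (fact P(1))
    have "carrier (coord_ring r) = P" using P(2) one_imp_carrier by (simp add: coord_ring_def)
    then show False using I_notcarr by blast
  qed
  then have "openin (zariski_topology r) (proj_space r :: 'k poly_nat set set)"
    unfolding openin_zariski using one by (intro exI[of _ "{1}"]) simp
  then show ?thesis
    by (intro antisym openin_subset) (auto simp: topspace_def openin_zariski)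
qed

lemma closedin_zariski:
  fixes C :: "('k::field) poly_nat set set"
  shows "closedin (zariski_topology r) C \<longleftrightarrow> (\<exists>E \<subseteq> all_forms r. C = zero_locus r E)"
proof -
  have "zero_locus r E \<subseteq> proj_space r" for E :: "'k poly_nat set" by (auto simp: zero_locus_def)
  then show ?thesis
    unfolding closedin_def openin_zariski topspace_zariski by blast
qed

lemma UN_UN_constant:
  assumes "A \<noteq> {}" "B \<noteq> {}"
    and g: "\<And>a s b t. (a, s) \<in> A \<Longrightarrow> (b, t) \<in> B \<Longrightarrow> g a s b t = C"
  shows "(\<Union>(a, s) \<in> A. \<Union>(b, t) \<in> B. g a s b t) = C"
proof -
  have "(\<Union>p \<in> A. \<Union>q \<in> B. g (fst p) (snd p) (fst q) (snd q)) = (\<Union>p \<in> A. \<Union>q \<in> B. C)"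
    by (intro SUP_cong refl g) simp_all
  then show ?thesis using assms(1,2) by (simp add: case_prod_beta)
qed

context cring
begin

lemma nonzerodivisors_closed [simp]: "s \<in> nonzerodivisors R \<Longrightarrow> s \<in> carrier R"
  unfolding nonzerodivisors_def by blast

lemma nonzerodivisorsD:
  "s \<in> nonzerodivisors R \<Longrightarrow> a \<in> carrier R \<Longrightarrow> s \<otimes> a = \<zero> \<Longrightarrow> a = \<zero>"
  unfolding nonzerodivisors_def by blast

lemma nonzerodivisors_one [simp]: "\<one> \<in> nonzerodivisors R"
  unfolding nonzerodivisors_def by (intro CollectI conjI ballI impI one_closed) (metis l_one)

lemma nonzerodivisors_mult [simp]:
  assumes "s \<in> nonzerodivisors R" "t \<in> nonzerodivisors R"
  shows "s \<otimes> t \<in> nonzerodivisors R"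
proof -
  have "a = \<zero>" if "a \<in> carrier R" "s \<otimes> t \<otimes> a = \<zero>" for a
  proof -
    have "s \<otimes> (t \<otimes> a) = \<zero>" using assms that by (simp add: m_assoc)
    then have "t \<otimes> a = \<zero>"
      by (rule nonzerodivisorsD[OF assms(1), rotated]) (use assms that in simp)
    then show ?thesis using nonzerodivisorsD[OF assms(2)] that by blast
  qed
  moreover have "s \<otimes> t \<in> carrier R" using assms by simp
  ultimately show ?thesis unfolding nonzerodivisors_def by blast
qed

lemma nonzerodivisors_cancel:
  assumes "s \<in> nonzerodivisors R" "a \<in> carrier R" "b \<in> carrier R" "s \<otimes> a = s \<otimes> b"
  shows "a = b"
proof -
  have s: "s \<in> carrier R" using assms(1) by simp
  have "s \<otimes> (a \<ominus> b) = s \<otimes> a \<ominus> s \<otimes> b"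
    using s assms(2,3) by (simp add: a_minus_def r_distr r_minus)
  also have "\<dots> = \<zero>" using s assms(2-4) by simp
  finally have "a \<ominus> b = \<zero>"
    by (rule nonzerodivisorsD[OF assms(1), rotated]) (use assms(2,3) in simp)
  then show ?thesis using assms(2,3) by simp
qed

lemma equiv_fraction_rel: "equiv (carrier R \<times> nonzerodivisors R) (fraction_rel R)"
proof (rule equivI)
  show "fraction_rel R \<subseteq> (carrier R \<times> nonzerodivisors R) \<times> (carrier R \<times> nonzerodivisors R)"
    by (auto simp: fraction_rel_def)
  show "refl_on (carrier R \<times> nonzerodivisors R) (fraction_rel R)"
    by (auto simp: refl_on_def fraction_rel_def)
  show "sym (fraction_rel R)" by (auto simp: sym_def fraction_rel_def)
  show "trans (fraction_rel R)"
  proof (rule transI, clarify)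
    fix a s b t c u
    assume "((a, s), (b, t)) \<in> fraction_rel R" "((b, t), (c, u)) \<in> fraction_rel R"
    then have a: "a \<in> carrier R" "s \<in> nonzerodivisors R"
      and b: "b \<in> carrier R" "t \<in> nonzerodivisors R"
      and c: "c \<in> carrier R" "u \<in> nonzerodivisors R"
      and e: "a \<otimes> t = b \<otimes> s" "b \<otimes> u = c \<otimes> t"
      by (auto simp: fraction_rel_def)
    have "t \<otimes> (a \<otimes> u) = (a \<otimes> t) \<otimes> u" using a b c by (simp add: m_ac)
    also have "\<dots> = (b \<otimes> s) \<otimes> u" by (simp only: e)
    also have "\<dots> = (b \<otimes> u) \<otimes> s" using a b c by (simp add: m_ac)
    also have "\<dots> = (c \<otimes> t) \<otimes> s" by (simp only: e)
    also have "\<dots> = t \<otimes> (c \<otimes> s)" using a b c by (simp add: m_ac)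
    finally have "a \<otimes> u = c \<otimes> s"
      by (rule nonzerodivisors_cancel[OF b(2), rotated 2]) (use a b c in simp_all)
    then show "((a, s), (c, u)) \<in> fraction_rel R"
      using a c by (simp add: fraction_rel_def)
  qed
qed

lemma fraction_eq_iff:
  assumes "a \<in> carrier R" "b \<in> carrier R" "s \<in> nonzerodivisors R" "t \<in> nonzerodivisors R"
  shows "fraction R a s = fraction R b t \<longleftrightarrow> a \<otimes> t = b \<otimes> s"
  unfolding fraction_def using assms
  by (subst eq_equiv_class_iff[OF equiv_fraction_rel]) (auto simp: fraction_rel_def)

lemma total_quotient_ring_cases:
  assumes "x \<in> carrier (total_quotient_ring R)"
  obtains a s where "a \<in> carrier R" "s \<in> nonzerodivisors R" "x = fraction R a s"
  using assms by (auto simp: total_quotient_ring_def fraction_def elim!: quotientE)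

lemma fraction_closed [simp]:
  "a \<in> carrier R \<Longrightarrow> s \<in> nonzerodivisors R \<Longrightarrow> fraction R a s \<in> carrier (total_quotient_ring R)"
  by (simp add: total_quotient_ring_def fraction_def quotientI)

lemma fraction_mult:
  assumes "a \<in> carrier R" "b \<in> carrier R" "s \<in> nonzerodivisors R" "t \<in> nonzerodivisors R"
  shows "fraction R a s \<otimes>\<^bsub>total_quotient_ring R\<^esub> fraction R b t = fraction R (a \<otimes> b) (s \<otimes> t)"
proof -
  have eq: "fraction R (a' \<otimes> b') (s' \<otimes> t') = fraction R (a \<otimes> b) (s \<otimes> t)"
    if "((a, s), (a', s')) \<in> fraction_rel R" "((b, t), (b', t')) \<in> fraction_rel R" for a' b' s' t'
  proof -
    have c: "a' \<in> carrier R" "b' \<in> carrier R" "s' \<in> nonzerodivisors R" "t' \<in> nonzerodivisors R"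
      and e: "a \<otimes> s' = a' \<otimes> s" "b \<otimes> t' = b' \<otimes> t" using that by (auto simp: fraction_rel_def)
    have "(a' \<otimes> b') \<otimes> (s \<otimes> t) = (a' \<otimes> s) \<otimes> (b' \<otimes> t)" using assms c by (simp add: m_ac)
    also have "\<dots> = (a \<otimes> s') \<otimes> (b \<otimes> t')" by (simp only: e)
    also have "\<dots> = (a \<otimes> b) \<otimes> (s' \<otimes> t')" using assms c by (simp add: m_ac)
    finally show ?thesis using assms c by (subst fraction_eq_iff) simp_all
  qed
  have "(a, s) \<in> fraction R a s" "(b, t) \<in> fraction R b t"
    using assms by (auto simp: fraction_def fraction_rel_def)
  then have "(\<Union>(a', s') \<in> fraction R a s. \<Union>(b', t') \<in> fraction R b t. fraction R (a' \<otimes> b') (s' \<otimes> t'))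
      = fraction R (a \<otimes> b) (s \<otimes> t)"
    by (intro UN_UN_constant eq) (auto simp: fraction_def)
  then show ?thesis by (simp add: total_quotient_ring_def)
qed

lemma fraction_add:
  assumes "a \<in> carrier R" "b \<in> carrier R" "s \<in> nonzerodivisors R" "t \<in> nonzerodivisors R"
  shows "fraction R a s \<oplus>\<^bsub>total_quotient_ring R\<^esub> fraction R b t = fraction R (a \<otimes> t \<oplus> b \<otimes> s) (s \<otimes> t)"
proof -
  have eq: "fraction R (a' \<otimes> t' \<oplus> b' \<otimes> s') (s' \<otimes> t') = fraction R (a \<otimes> t \<oplus> b \<otimes> s) (s \<otimes> t)"
    if "((a, s), (a', s')) \<in> fraction_rel R" "((b, t), (b', t')) \<in> fraction_rel R" for a' b' s' t'
  proof -
    have c: "a' \<in> carrier R" "b' \<in> carrier R" "s' \<in> nonzerodivisors R" "t' \<in> nonzerodivisors R"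
      and e: "a \<otimes> s' = a' \<otimes> s" "b \<otimes> t' = b' \<otimes> t" using that by (auto simp: fraction_rel_def)
    have "(a' \<otimes> t' \<oplus> b' \<otimes> s') \<otimes> (s \<otimes> t) = (a' \<otimes> s) \<otimes> (t \<otimes> t') \<oplus> (b' \<otimes> t) \<otimes> (s \<otimes> s')"
      using assms c by (simp add: l_distr r_distr m_ac)
    also have "\<dots> = (a \<otimes> s') \<otimes> (t \<otimes> t') \<oplus> (b \<otimes> t') \<otimes> (s \<otimes> s')" by (simp only: e)
    also have "\<dots> = (a \<otimes> t \<oplus> b \<otimes> s) \<otimes> (s' \<otimes> t')" using assms c by (simp add: l_distr r_distr m_ac)
    finally show ?thesis using assms c by (subst fraction_eq_iff) simp_all
  qed
  have "(a, s) \<in> fraction R a s" "(b, t) \<in> fraction R b t"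
    using assms by (auto simp: fraction_def fraction_rel_def)
  then have "(\<Union>(a', s') \<in> fraction R a s. \<Union>(b', t') \<in> fraction R b t.
        fraction R (a' \<otimes> t' \<oplus> b' \<otimes> s') (s' \<otimes> t')) = fraction R (a \<otimes> t \<oplus> b \<otimes> s) (s \<otimes> t)"
    by (intro UN_UN_constant eq) (auto simp: fraction_def)
  then show ?thesis by (simp add: total_quotient_ring_def)
qed

lemma total_quotient_ring_one: "\<one>\<^bsub>total_quotient_ring R\<^esub> = fraction R \<one> \<one>"
  and total_quotient_ring_zero: "\<zero>\<^bsub>total_quotient_ring R\<^esub> = fraction R \<zero> \<one>"
  by (simp_all add: total_quotient_ring_def)

lemma total_quotient_ring_add_assoc:
  assumes x: "x \<in> carrier (total_quotient_ring R)" and y: "y \<in> carrier (total_quotient_ring R)"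
    and z: "z \<in> carrier (total_quotient_ring R)"
  shows "(x \<oplus>\<^bsub>total_quotient_ring R\<^esub> y) \<oplus>\<^bsub>total_quotient_ring R\<^esub> z =
    x \<oplus>\<^bsub>total_quotient_ring R\<^esub> (y \<oplus>\<^bsub>total_quotient_ring R\<^esub> z)"
proof -
  obtain a s where a: "a \<in> carrier R" "s \<in> nonzerodivisors R" and [simp]: "x = fraction R a s"
    using x by (rule total_quotient_ring_cases)
  obtain b t where b: "b \<in> carrier R" "t \<in> nonzerodivisors R" and [simp]: "y = fraction R b t"
    using y by (rule total_quotient_ring_cases)
  obtain c u where c: "c \<in> carrier R" "u \<in> nonzerodivisors R" and [simp]: "z = fraction R c u"
    using z by (rule total_quotient_ring_cases)
  have "(a \<otimes> t \<oplus> b \<otimes> s) \<otimes> u \<oplus> c \<otimes> (s \<otimes> t) = a \<otimes> (t \<otimes> u) \<oplus> (b \<otimes> u \<oplus> c \<otimes> t) \<otimes> s"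
    using a b c by (simp add: l_distr r_distr m_ac a_assoc)
  moreover have "s \<otimes> t \<otimes> u = s \<otimes> (t \<otimes> u)" using a b c by (simp add: m_assoc)
  ultimately show ?thesis using a b c by (simp add: fraction_add)
qed

lemma total_quotient_ring_l_distr:
  assumes x: "x \<in> carrier (total_quotient_ring R)" and y: "y \<in> carrier (total_quotient_ring R)"
    and z: "z \<in> carrier (total_quotient_ring R)"
  shows "(x \<oplus>\<^bsub>total_quotient_ring R\<^esub> y) \<otimes>\<^bsub>total_quotient_ring R\<^esub> z =
    (x \<otimes>\<^bsub>total_quotient_ring R\<^esub> z) \<oplus>\<^bsub>total_quotient_ring R\<^esub> (y \<otimes>\<^bsub>total_quotient_ring R\<^esub> z)"
proof -
  obtain a s where a: "a \<in> carrier R" "s \<in> nonzerodivisors R" and [simp]: "x = fraction R a s"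
    using x by (rule total_quotient_ring_cases)
  obtain b t where b: "b \<in> carrier R" "t \<in> nonzerodivisors R" and [simp]: "y = fraction R b t"
    using y by (rule total_quotient_ring_cases)
  obtain c u where c: "c \<in> carrier R" "u \<in> nonzerodivisors R" and [simp]: "z = fraction R c u"
    using z by (rule total_quotient_ring_cases)
  have "(a \<otimes> t \<oplus> b \<otimes> s) \<otimes> c \<otimes> (s \<otimes> u \<otimes> (t \<otimes> u)) =
      (a \<otimes> c \<otimes> (t \<otimes> u) \<oplus> b \<otimes> c \<otimes> (s \<otimes> u)) \<otimes> (s \<otimes> t \<otimes> u)"
    using a b c by (simp add: l_distr r_distr m_ac)
  then show ?thesis using a b c by (simp add: fraction_add fraction_mult fraction_eq_iff)
qed

lemma cring_total_quotient_ring: "cring (total_quotient_ring R)"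
proof (rule cringI)
  show "abelian_group (total_quotient_ring R)"
  proof (rule abelian_groupI)
    show "\<zero>\<^bsub>total_quotient_ring R\<^esub> \<in> carrier (total_quotient_ring R)"
      by (simp add: total_quotient_ring_zero)
  next
    fix x y
    assume "x \<in> carrier (total_quotient_ring R)" "y \<in> carrier (total_quotient_ring R)"
    then show "x \<oplus>\<^bsub>total_quotient_ring R\<^esub> y \<in> carrier (total_quotient_ring R)"
      and "x \<oplus>\<^bsub>total_quotient_ring R\<^esub> y = y \<oplus>\<^bsub>total_quotient_ring R\<^esub> x"
      by (auto elim!: total_quotient_ring_cases simp: fraction_add m_comm a_comm)
  next
    fix x assume "x \<in> carrier (total_quotient_ring R)"
    then obtain a s where a: "a \<in> carrier R" "s \<in> nonzerodivisors R" "x = fraction R a s"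
      by (rule total_quotient_ring_cases)
    then show "\<zero>\<^bsub>total_quotient_ring R\<^esub> \<oplus>\<^bsub>total_quotient_ring R\<^esub> x = x"
      by (simp add: total_quotient_ring_zero fraction_add)
    show "\<exists>y \<in> carrier (total_quotient_ring R).
        y \<oplus>\<^bsub>total_quotient_ring R\<^esub> x = \<zero>\<^bsub>total_quotient_ring R\<^esub>"
    proof
      show "fraction R (\<ominus> a) s \<oplus>\<^bsub>total_quotient_ring R\<^esub> x = \<zero>\<^bsub>total_quotient_ring R\<^esub>"
        using a by (simp add: total_quotient_ring_zero fraction_add fraction_eq_iff l_minus l_neg)
    qed (use a in simp)
  qed (rule total_quotient_ring_add_assoc)
  show "comm_monoid (total_quotient_ring R)"
    by (rule comm_monoidI)
      (auto elim!: total_quotient_ring_cases simp: fraction_mult total_quotient_ring_one m_ac)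
qed (rule total_quotient_ring_l_distr)

end

end

theory Submission
  imports Defs "HOL-Computational_Algebra.Polynomial"
begin

text \<open>
  Let \<open>I\<^sub>X = (F)\<close>.  The polynomial ring is factorial and \<open>X\<close> is reduced, so \<open>F\<close> is, up to a
  constant, a product of pairwise non-associate primes \<open>f\<close>, and the components of \<open>X\<close> are the
  hypersurfaces \<open>f = 0\<close>.  Write \<open>G\<^sub>f = F / f\<close>.  Since every ideal involved except the conductors is
  principal, the claim is \<open>\<CC>'\<^sub>X = \<Sum>\<^sub>f \<CC>'\<^sub>f G\<^sub>f\<close>.

  The total quotient ring of \<open>S / F\<close> is the product of the fraction fields of the rings \<open>S / f\<close>, and
  the normalization splits accordingly.  Thus a fraction \<open>a / t\<close> that is integral over \<open>S / f\<close> can be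
  extended by zero to the other components; the extension is \<open>a G\<^sub>f / (t G\<^sub>f + f)\<close>, as one sees by
  reducing modulo each prime.  If \<open>s\<close> lies in \<open>\<CC>'\<^sub>X\<close>, then \<open>s\<close> times this extension is the class of a
  polynomial that vanishes on all other components, that is, of some \<open>G\<^sub>f v\<close>.  Taking \<open>a / t = 1\<close>
  gives \<open>h\<^sub>f\<close> with \<open>s \<equiv> G\<^sub>f h\<^sub>f\<close> modulo \<open>f\<close>, and then the general case, after cancelling \<open>G\<^sub>f\<close> in the
  domain \<open>S / f\<close>, says that \<open>h\<^sub>f\<close> lies in \<open>\<CC>'\<^sub>f\<close>.  Now \<open>s - \<Sum>\<^sub>f G\<^sub>f h\<^sub>f\<close> is divisible by every \<open>f\<close>,
  hence by \<open>F\<close>, and a multiple of \<open>F\<close> can be absorbed into any one summand.  The other inclusion is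
  immediate: multiplying a congruence modulo \<open>f\<close> by \<open>G\<^sub>f\<close> makes it a congruence modulo \<open>F\<close>.  These
  two halves are \<open>conductor_subset_sum\<close> and \<open>component_conductor_times_complement\<close>.  They are stated
  in terms of divisibility of polynomials; \<open>conductor_iff\<close> is the translation.

  Three further facts carry the proof.  Unique factorization, by induction on the number of
  variables, is \<open>prime_divisor_exists\<close>: Gauss's argument with pseudo-division in place of
  fraction fields.  Factors of forms are forms (\<open>form_factor\<close>), since the grading turns a form into a
  monomial in an extra variable.  Finally, \<open>component_subschemes_hypersurface\<close> identifies the
  irreducible components by means of their generic points \<open>(f)\<close>.
\<close>

section \<open>Gradings of the polynomial ring\<close>

abbreviation "pcoeff \<equiv> Polynomial.coeff"
abbreviation "pdegree \<equiv> Polynomial.degree"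
abbreviation "pmonom \<equiv> Polynomial.monom"

text \<open>
  The image of \<open>f\<close> under \<open>x\<^sup>m \<mapsto> x\<^sup>m y\<^bsup>w m\<^esup>\<close> with one new variable \<open>y\<close>.  For additive \<open>w\<close> this is a
  ring homomorphism whose coefficients are the homogeneous components of \<open>f\<close>, so properties of the
  degree of univariate polynomials carry over to every weight.  The weights used are the total degree
  and the exponent of a single variable.
\<close>

definition grading :: "((nat \<Rightarrow>\<^sub>0 nat) \<Rightarrow> nat) \<Rightarrow> ('k::field) poly_nat \<Rightarrow> 'k poly_nat poly" where
  "grading w f = (\<Sum>m \<in> Poly_Mapping.keys f. pmonom (Poly_Mapping.single m (Poly_Mapping.lookup f m)) (w m))"

lemma lookup_coeff_grading:
  "Poly_Mapping.lookup (pcoeff (grading w f) d) m = (if w m = d then Poly_Mapping.lookup f m else 0)"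
proof -
  have "Poly_Mapping.lookup (pcoeff (grading w f) d) m =
      (\<Sum>m' \<in> Poly_Mapping.keys f. if m' = m then (if w m = d then Poly_Mapping.lookup f m else 0) else 0)"
    unfolding grading_def coeff_sum lookup_sum
    by (intro sum.cong) (auto simp: lookup_single when_def)
  then show ?thesis by (auto simp: in_keys_iff)
qed

lemma grading_eqI:
  assumes "\<And>d m. Poly_Mapping.lookup (pcoeff p d) m = (if w m = d then Poly_Mapping.lookup f m else 0)"
  shows "grading w f = p"
  by (rule poly_eqI, rule poly_mapping_eqI) (simp only: assms lookup_coeff_grading)

lemma grading_zero [simp]: "grading w 0 = 0"
  by (simp add: grading_def)

lemma grading_add: "grading w (f + g) = grading w f + grading w g"
  by (rule grading_eqI) (simp add: lookup_coeff_grading lookup_add)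

lemma grading_single [simp]: "grading w (Poly_Mapping.single m c) = pmonom (Poly_Mapping.single m c) (w m)"
  by (rule grading_eqI) (auto simp: lookup_single when_def)

lemma poly_nat_induct [case_names single add]:
  fixes f :: "('k::field) poly_nat"
  assumes single: "\<And>m c. P (Poly_Mapping.single m c)"
    and add: "\<And>f g. P f \<Longrightarrow> P g \<Longrightarrow> P (f + g)"
  shows "P f"
proof -
  have "P (\<Sum>m\<in>A. Poly_Mapping.single m (Poly_Mapping.lookup f m))" if "finite A" for A
    using that
  proof (induction A)
    case empty
    then show ?case using single[of 0 0] by simp
  next
    case (insert m A)
    then show ?case by (simp add: add single)
  qed
  moreover have "f = (\<Sum>m\<in>Poly_Mapping.keys f. Poly_Mapping.single m (Poly_Mapping.lookup f m))"
    by (intro poly_mapping_eqI)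
      (simp add: lookup_sum lookup_single when_def in_keys_iff)
  ultimately show ?thesis by (metis finite_keys)
qed

lemma grading_mult:
  assumes w: "\<And>a b. w (a + b) = w a + w b"
  shows "grading w (f * g) = grading w f * grading w g"
proof (induction f rule: poly_nat_induct)
  case (single m c)
  show ?case
    by (induction g rule: poly_nat_induct)
      (simp_all add: mult_single mult_monom w distrib_left grading_add)
qed (simp add: distrib_right grading_add)

lemma poly_grading_1 [simp]: "poly (grading w f) 1 = f"
  by (induction f rule: poly_nat_induct) (simp_all add: grading_add poly_monom)

lemma grading_eq_0_iff [simp]: "grading w f = 0 \<longleftrightarrow> f = 0"
  by (metis grading_zero poly_0 poly_grading_1)

lemma degree_grading_eq_0_iff:
  "pdegree (grading w f) = 0 \<longleftrightarrow> (\<forall>m \<in> Poly_Mapping.keys f. w m = 0)"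
proof
  assume "pdegree (grading w f) = 0"
  then have "pcoeff (grading w f) d = 0" if "d > 0" for d
    using that by (simp add: coeff_eq_0)
  then show "\<forall>m \<in> Poly_Mapping.keys f. w m = 0"
    using lookup_coeff_grading[of w f] by (metis in_keys_iff lookup_zero neq0_conv)
next
  assume "\<forall>m \<in> Poly_Mapping.keys f. w m = 0"
  then have "pcoeff (grading w f) d = 0" if "d > 0" for d
    using that by (intro poly_mapping_eqI) (force simp: lookup_coeff_grading in_keys_iff)
  then have "pdegree (grading w f) \<le> 0" by (intro degree_le) blast
  then show "pdegree (grading w f) = 0" by simp
qed

lemma degree_grading_mult:
  assumes "\<And>a b. w (a + b) = w a + w b" "f \<noteq> 0" "g \<noteq> 0"
  shows "pdegree (grading w (f * g)) = pdegree (grading w f) + pdegree (grading w g)"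
  unfolding grading_mult[OF assms(1)] using assms(2,3) by (intro degree_mult_eq) simp_all

abbreviation total_deg :: "('k::field) poly_nat \<Rightarrow> nat" where
  "total_deg f \<equiv> pdegree (grading total_degree f)"

lemma total_degree_eq_0_iff: "total_degree m = 0 \<longleftrightarrow> m = 0"
proof
  assume "total_degree m = 0"
  then have "\<forall>i \<in> Poly_Mapping.keys m. Poly_Mapping.lookup m i = 0" by (simp add: total_degree_def)
  then have "Poly_Mapping.lookup m i = 0" for i by (metis in_keys_iff)
  then show "m = 0" by (intro poly_mapping_eqI) simp
qed (simp add: total_degree_def)

lemma total_deg_eq_0_iff:
  fixes f :: "('k::field) poly_nat"
  assumes "f \<noteq> 0"
  shows "total_deg f = 0 \<longleftrightarrow> f dvd 1"
proof
  assume "total_deg f = 0"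
  then have "Poly_Mapping.keys f \<subseteq> {0}"
    by (auto simp: degree_grading_eq_0_iff total_degree_eq_0_iff)
  then have f: "f = Poly_Mapping.single 0 (Poly_Mapping.lookup f 0)"
    by (intro poly_mapping_eqI) (auto simp: lookup_single when_def in_keys_iff subset_iff)
  with assms have "Poly_Mapping.lookup f 0 \<noteq> 0" by (metis single_zero)
  then have "f * Poly_Mapping.single 0 (inverse (Poly_Mapping.lookup f 0)) = 1"
    by (subst f) (simp add: mult_single)
  then show "f dvd 1" by (metis dvdI)
next
  assume "f dvd 1"
  then obtain g where "f * g = 1" by (metis dvdE)
  then have "total_deg f + total_deg g = total_deg (1 :: 'k poly_nat)"
    using assms degree_grading_mult[where w = total_degree and f = f and g = g] total_degree_add
    by (metis mult_zero_right zero_neq_one)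
  moreover have "total_deg (1 :: 'k poly_nat) = 0"
    unfolding degree_grading_eq_0_iff by (simp add: total_degree_eq_0_iff)
  ultimately show "total_deg f = 0" by simp
qed

text \<open>
  Makes the total degree a termination measure for factorization.
\<close>

lemma total_deg_factor_less:
  fixes f g :: "('k::field) poly_nat"
  assumes "f \<noteq> 0" "g \<noteq> 0" "\<not> g dvd 1"
  shows "total_deg f < total_deg (f * g)"
proof -
  have "total_deg (f * g) = total_deg f + total_deg g"
    by (rule degree_grading_mult[where w = total_degree and f = f and g = g])
      (simp_all only: total_degree_add assms not_False_eq_True)
  moreover have "total_deg g \<noteq> 0" using total_deg_eq_0_iff[OF assms(2)] assms(3) by blast
  ultimately show ?thesis by linarith
qed

section \<open>Polynomials in finitely many variables\<close>

definition vars :: "nat \<Rightarrow> ('k::field) poly_nat set" where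
  "vars n = {f. \<forall>m \<in> Poly_Mapping.keys f. Poly_Mapping.keys m \<subseteq> {..<n}}"

lemma carrier_coord_ring: "carrier (coord_ring r) = vars (Suc r)"
  by (simp add: coord_ring_def vars_def lessThan_Suc_atMost)

lemma vars_iff_degree:
  "f \<in> vars n \<longleftrightarrow> (\<forall>i\<ge>n. pdegree (grading (\<lambda>m. Poly_Mapping.lookup m i) f) = 0)"
proof -
  have *: "Poly_Mapping.keys m \<subseteq> {..<n} \<longleftrightarrow> (\<forall>i\<ge>n. Poly_Mapping.lookup m i = 0)"
    for m :: "nat \<Rightarrow>\<^sub>0 nat"
  proof
    assume "Poly_Mapping.keys m \<subseteq> {..<n}"
    then have "i \<notin> Poly_Mapping.keys m" if "i \<ge> n" for i using that by auto
    then show "\<forall>i\<ge>n. Poly_Mapping.lookup m i = 0" by (simp add: in_keys_iff)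
  next
    assume *: "\<forall>i\<ge>n. Poly_Mapping.lookup m i = 0"
    show "Poly_Mapping.keys m \<subseteq> {..<n}"
    proof
      fix i assume "i \<in> Poly_Mapping.keys m"
      then show "i \<in> {..<n}" using * by (cases "i < n") (simp_all add: in_keys_iff)
    qed
  qed
  show ?thesis
    unfolding vars_def degree_grading_eq_0_iff mem_Collect_eq * by blast
qed

text \<open>
  The degree in each variable is additive on products, so no variable can cancel.  Consequently
  divisibility inside \<open>K[x\<^sub>0, \<dots>, x\<^bsub>n-1\<^esub>]\<close> agrees with divisibility in the ring with infinitely many
  variables, and the latter can be used throughout.
\<close>

lemma vars_factor:
  assumes "f \<in> vars n" "f \<noteq> 0" "g dvd f"
  shows "g \<in> vars n"
proof -
  obtain h where h: "f = g * h" using assms(3) by (metis dvdE)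
  show ?thesis
    unfolding vars_iff_degree
  proof (intro allI impI)
    fix i assume "n \<le> i"
    then have "pdegree (grading (\<lambda>m. Poly_Mapping.lookup m i) (g * h)) = 0"
      using assms(1) h vars_iff_degree by blast
    then show "pdegree (grading (\<lambda>m. Poly_Mapping.lookup m i) g) = 0"
      using assms(2) h by (subst (asm) degree_grading_mult) (auto simp: lookup_add)
  qed
qed

lemma vars_0 [simp]: "0 \<in> vars n" and vars_1 [simp]: "1 \<in> vars n"
  by (simp_all add: vars_def)

lemma vars_add [simp]: "f \<in> vars n \<Longrightarrow> g \<in> vars n \<Longrightarrow> f + g \<in> vars n"
  unfolding vars_def using keys_add[of f g] by blast

lemma vars_uminus [simp]: "f \<in> vars n \<Longrightarrow> - f \<in> vars n"
  by (simp add: vars_def)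

lemma vars_diff [simp]: "f \<in> vars n \<Longrightarrow> g \<in> vars n \<Longrightarrow> f - g \<in> vars n"
  using vars_add[of f n "- g"] by simp

lemma vars_mult [simp]:
  assumes "f \<in> vars n" "g \<in> vars n"
  shows "f * g \<in> vars n"
proof (cases n)
  case 0
  have "Poly_Mapping.keys m \<subseteq> {}" if "m \<in> Poly_Mapping.keys (f * g)" for m
    using that keys_mult[of f g] assms keys_add 0 by (fastforce simp: vars_def)
  then show ?thesis by (auto simp: vars_def 0)
next
  case (Suc r)
  then show ?thesis using assms carrier_coord_ring_mult[of f r g] by (simp add: carrier_coord_ring)
qed

lemma vars_power [simp]: "f \<in> vars n \<Longrightarrow> f ^ k \<in> vars n"
  by (induction k) simp_all

lemma vars_sum: "(\<And>i. i \<in> A \<Longrightarrow> f i \<in> vars n) \<Longrightarrow> sum f A \<in> vars n"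
  by (induction A rule: infinite_finite_induct) simp_all

lemma vars_prod: "(\<And>i. i \<in> A \<Longrightarrow> f i \<in> vars n) \<Longrightarrow> prod f A \<in> vars n"
  by (induction A rule: infinite_finite_induct) simp_all

lemma vars_mono: "n \<le> n' \<Longrightarrow> vars n \<subseteq> vars n'"
  unfolding vars_def by fastforce

lemma vars_exhaust: "\<exists>n. f \<in> vars n"
proof -
  have "finite (\<Union>m \<in> Poly_Mapping.keys f. Poly_Mapping.keys m)" by simp
  then obtain n where "(\<Union>m \<in> Poly_Mapping.keys f. Poly_Mapping.keys m) \<subseteq> {..<n}"
    by (metis finite_nat_iff_bounded)
  then show ?thesis by (auto simp: vars_def)
qed

lemma coord_in_vars: "i < n \<Longrightarrow> coord i \<in> vars n"
  by (simp add: coord_def vars_def)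

lemma coord_power: "coord i ^ k = Poly_Mapping.single (Poly_Mapping.single i k) 1"
  by (induction k) (simp_all add: coord_def mult_single single_add[symmetric])

lemma coord_nonzero [simp]: "coord i \<noteq> (0 :: ('k::field) poly_nat)"
  by (metis coord_def lookup_single_eq lookup_zero zero_neq_one)

abbreviation coeffs_in :: "'a::zero set \<Rightarrow> 'a poly \<Rightarrow> bool" where
  "coeffs_in R P \<equiv> \<forall>i. pcoeff P i \<in> R"

lemma vars_Suc_as_poly:
  fixes f :: "('k::field) poly_nat"
  assumes "f \<in> vars (Suc n)"
  obtains P where "coeffs_in (vars n) P" "poly P (coord n) = f"
proof -
  define part where "part m = m - Poly_Mapping.single n (Poly_Mapping.lookup m n)" for m :: "nat \<Rightarrow>\<^sub>0 nat"
  have part: "m = part m + Poly_Mapping.single n (Poly_Mapping.lookup m n)" for m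
    by (intro poly_mapping_eqI) (auto simp: part_def lookup_add lookup_minus lookup_single when_def)
  have keys_part: "Poly_Mapping.keys (part m) \<subseteq> {..<n}" if "Poly_Mapping.keys m \<subseteq> {..<Suc n}" for m
  proof
    fix i assume "i \<in> Poly_Mapping.keys (part m)"
    then have "i \<noteq> n" "i \<in> Poly_Mapping.keys m"
      by (auto simp: part_def in_keys_iff lookup_minus lookup_single when_def split: if_splits)
    then show "i \<in> {..<n}" using that by (force simp: subset_iff)
  qed
  define P where "P = (\<Sum>m \<in> Poly_Mapping.keys f.
    pmonom (Poly_Mapping.single (part m) (Poly_Mapping.lookup f m)) (Poly_Mapping.lookup m n))"
  show ?thesis
  proof
    have "Poly_Mapping.single (part m) (Poly_Mapping.lookup f m) \<in> vars n"
      if "m \<in> Poly_Mapping.keys f" for m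
      using that keys_part assms by (auto simp: vars_def)
    then show "coeffs_in (vars n) P"
      unfolding P_def coeff_sum by (auto intro!: vars_sum)
    have "poly P (coord n) = (\<Sum>m \<in> Poly_Mapping.keys f. Poly_Mapping.single m (Poly_Mapping.lookup f m))"
      unfolding P_def poly_sum
      by (intro sum.cong refl) (simp add: poly_monom coord_power mult_single part[symmetric])
    also have "\<dots> = f"
      by (intro poly_mapping_eqI) (simp add: lookup_sum lookup_single when_def in_keys_iff)
    finally show "poly P (coord n) = f" .
  qed
qed

text \<open>
  Grading by the exponent of \<open>x\<^sub>n\<close> sends \<open>P(x\<^sub>n)\<close> to \<open>P(x\<^sub>n y)\<close>, from which \<open>P\<close> can be recovered.
\<close>

lemma coord_transcendental:
  fixes P :: "('k::field) poly_nat poly"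
  assumes "coeffs_in (vars n) P" "poly P (coord n) = 0"
  shows "P = 0"
proof -
  define w where "w = (\<lambda>m::nat \<Rightarrow>\<^sub>0 nat. Poly_Mapping.lookup m n)"
  have w: "w (a + b) = w a + w b" for a b by (simp add: w_def lookup_add)
  have const: "grading w a = [:a:]" if "a \<in> vars n" for a :: "'k poly_nat"
  proof (rule grading_eqI)
    fix d m
    have "Poly_Mapping.lookup a m = 0" if "w m \<noteq> 0"
    proof (rule ccontr)
      assume "Poly_Mapping.lookup a m \<noteq> 0"
      then have "m \<in> Poly_Mapping.keys a" by (simp add: in_keys_iff)
      then have "Poly_Mapping.keys m \<subseteq> {..<n}" using \<open>a \<in> vars n\<close> by (simp add: vars_def)
      then have "n \<notin> Poly_Mapping.keys m" by blast
      then show False using that by (simp add: w_def in_keys_iff)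
    qed
    then show "Poly_Mapping.lookup (pcoeff [:a:] d) m = (if w m = d then Poly_Mapping.lookup a m else 0)"
      by (cases d) auto
  qed
  have x: "grading w (coord n :: 'k poly_nat) = [:0, coord n:]"
    by (simp add: coord_def w_def monom_Suc monom_0)
  have "grading w (poly P (coord n)) = pcompose P [:0, coord n:]"
    using assms(1)
  proof (induction P)
    case (pCons a P)
    have "a \<in> vars n" "coeffs_in (vars n) P"
      using pCons.prems by (metis coeff_pCons_0, metis coeff_pCons_Suc)
    then show ?case
      using pCons.IH by (simp add: grading_add grading_mult[OF w] const x pcompose_pCons)
  qed simp
  then have "pcompose P [:0, coord n:] = 0" using assms(2) by simp
  then show ?thesis by (subst (asm) pcompose_eq_0_iff) auto
qed

section \<open>Unique factorization\<close>

text \<open>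
  Primality tested on factors from \<open>R\<close> only.  The induction on the number of variables has to speak
  about the prime elements of each \<open>K[x\<^sub>0, \<dots>, x\<^bsub>n-1\<^esub>]\<close>, while all of these rings live in one type.
\<close>

definition prime_in :: "'a::comm_semiring_1 set \<Rightarrow> 'a \<Rightarrow> bool" where
  "prime_in R p \<longleftrightarrow> p \<noteq> 0 \<and> \<not> p dvd 1 \<and> (\<forall>g \<in> R. \<forall>h \<in> R. p dvd g * h \<longrightarrow> p dvd g \<or> p dvd h)"

lemma coeffs_in_mult:
  fixes P Q :: "('k::field) poly_nat poly"
  assumes "coeffs_in (vars n) P" "coeffs_in (vars n) Q"
  shows "coeffs_in (vars n) (P * Q)"
  unfolding coeff_mult using assms by (auto intro: vars_sum)

lemma dvd_poly_evalI:
  fixes P :: "'a::comm_semiring_1 poly"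
  assumes "\<And>i. p dvd pcoeff P i"
  shows "p dvd poly P x"
  unfolding poly_altdef using assms by (intro dvd_sum dvd_mult2) 

text \<open>
  A prime of \<open>R\<close> stays prime in \<open>R[x]\<close>: if \<open>p\<close> divides neither \<open>g\<close> nor \<open>h\<close>, take the lowest
  coefficients of both that \<open>p\<close> does not divide; their product is, up to multiples of \<open>p\<close>, a
  coefficient of \<open>g h\<close>.
\<close>

lemma prime_in_vars_Suc:
  fixes p :: "('k::field) poly_nat"
  assumes p: "p \<in> vars n" and prime: "prime_in (vars n) p"
  shows "prime_in (vars (Suc n)) p"
  unfolding prime_in_def
proof (intro conjI ballI impI)
  show "p \<noteq> 0" "\<not> p dvd 1" using prime by (auto simp: prime_in_def)
next
  fix g h :: "'k poly_nat"
  assume g: "g \<in> vars (Suc n)" and h: "h \<in> vars (Suc n)" and dvd: "p dvd g * h"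
  show "p dvd g \<or> p dvd h"
  proof (rule ccontr)
    assume "\<not> (p dvd g \<or> p dvd h)"
    then have ng: "\<not> p dvd g" and nh: "\<not> p dvd h" by auto
    obtain G where G: "coeffs_in (vars n) G" "poly G (coord n) = g" using g by (rule vars_Suc_as_poly)
    obtain H where H: "coeffs_in (vars n) H" "poly H (coord n) = h" using h by (rule vars_Suc_as_poly)
    obtain k where k: "g * h = p * k" using dvd by (metis dvdE)
    have "g * h \<noteq> 0" using ng nh by auto
    then have "k \<in> vars (Suc n)"
      using vars_factor[OF vars_mult[OF g h]] by (metis k dvd_triv_right)
    then obtain K where K: "coeffs_in (vars n) K" "poly K (coord n) = k" by (rule vars_Suc_as_poly)
    have "coeffs_in (vars n) (G * H - smult p K)"
      using coeffs_in_mult[OF G(1) H(1)] K(1) p by simp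
    moreover have "poly (G * H - smult p K) (coord n) = 0" using G H K k by simp
    ultimately have GH: "G * H = smult p K"
      using coord_transcendental by fastforce
    define i where "i = (LEAST i. \<not> p dvd pcoeff G i)"
    define j where "j = (LEAST j. \<not> p dvd pcoeff H j)"
    have exi: "\<exists>i. \<not> p dvd pcoeff G i" and exj: "\<exists>j. \<not> p dvd pcoeff H j"
      using dvd_poly_evalI[of p G "coord n"] dvd_poly_evalI[of p H "coord n"] ng nh G H by blast+
    have i: "\<not> p dvd pcoeff G i" "\<And>i'. i' < i \<Longrightarrow> p dvd pcoeff G i'"
      unfolding i_def using LeastI_ex[OF exi] not_less_Least by blast+
    have j: "\<not> p dvd pcoeff H j" "\<And>j'. j' < j \<Longrightarrow> p dvd pcoeff H j'"
      unfolding j_def using LeastI_ex[OF exj] not_less_Least by blast+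
    have "p dvd pcoeff G l * pcoeff H (i + j - l)" if "l \<in> {..i + j} - {i}" for l
    proof (cases "l < i")
      case True
      then show ?thesis using i(2) by simp
    next
      case False
      then have "i + j - l < j" using that by auto
      then show ?thesis using j(2) by simp
    qed
    then have rest: "p dvd (\<Sum>l \<in> {..i + j} - {i}. pcoeff G l * pcoeff H (i + j - l))"
      by (rule dvd_sum)
    have sum: "pcoeff (G * H) (i + j) =
        pcoeff G i * pcoeff H j + (\<Sum>l \<in> {..i + j} - {i}. pcoeff G l * pcoeff H (i + j - l))"
      unfolding coeff_mult by (subst sum.remove[of _ i]) simp_all
    have "p dvd pcoeff (G * H) (i + j)" unfolding GH by simp
    then have "p dvd pcoeff G i * pcoeff H j"
      unfolding sum by (simp only: dvd_add_left_iff[OF rest])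
    then show False using prime G(1) H(1) i(1) j(1) unfolding prime_in_def by blast
  qed
qed

text \<open>
  Primality survives adding one variable at a time, and two given factors involve only finitely many
  variables.
\<close>

lemma prime_in_vars_imp_prime_elem:
  fixes p :: "('k::field) poly_nat"
  assumes p: "p \<in> vars n" and prime: "prime_in (vars n) p"
  shows "prime_elem p"
proof -
  have step: "prime_in (vars (n + k)) p" for k
  proof (induction k)
    case (Suc k)
    then show ?case using prime_in_vars_Suc[of p "n + k"] p vars_mono[of n "n + k"] by auto
  qed (simp add: prime)
  show ?thesis
  proof (rule prime_elemI)
    show "p \<noteq> 0" "\<not> p dvd 1" using prime by (auto simp: prime_in_def)
  next
    fix a b assume "p dvd a * b"
    obtain k l where "a \<in> vars k" "b \<in> vars l" using vars_exhaust by metis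
    then have "a \<in> vars (n + (k + l))" "b \<in> vars (n + (k + l))"
      using vars_mono[of k "n + (k + l)"] vars_mono[of l "n + (k + l)"] by auto
    then show "p dvd a \<or> p dvd b" using step \<open>p dvd a * b\<close> unfolding prime_in_def by blast
  qed
qed

abbreviation has_prime_divisors :: "('k::field) poly_nat set \<Rightarrow> bool" where
  "has_prime_divisors R \<equiv> (\<forall>a \<in> R. a \<noteq> 0 \<longrightarrow> \<not> a dvd 1 \<longrightarrow> (\<exists>p. prime_elem p \<and> p dvd a))"

text \<open>
  If \<open>a\<close> is a product of primes, then two factorizations \<open>a f = d e\<close> have a common refinement,
  because each prime factor of \<open>a\<close> can be cancelled against \<open>d\<close> or against \<open>e\<close>.  This takes the
  place of the usual computations with contents of polynomials.
\<close>

lemma refine_factorizations: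
  fixes a :: "('k::field) poly_nat"
  assumes R: "has_prime_divisors (vars n :: 'k poly_nat set)"
    and "a \<in> vars n" "a \<noteq> 0" "a * f = d * e"
  shows "\<exists>a1 a2 f1 f2. a = a1 * a2 \<and> f = f1 * f2 \<and> d = a1 * f1 \<and> e = a2 * f2"
  using assms(2-)
proof (induction "total_deg a" arbitrary: a d e rule: less_induct)
  case less
  show ?case
  proof (cases "a dvd 1")
    case True
    then obtain b where "1 = a * b" by (metis dvdE)
    then have "f = (b * d) * e \<and> d = a * (b * d)" using less.prems(3)
      by (metis mult.assoc mult.commute mult_1)
    then show ?thesis by (metis mult.right_neutral mult_1)
  next
    case False
    then obtain p where p: "prime_elem p" "p dvd a"
      using R less.prems(1,2) by auto
    then obtain b where b: "a = p * b" by (metis dvdE)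
    have b0: "b \<noteq> 0" "p \<noteq> 0" using b less.prems(2) by auto
    have "b dvd a" using b by simp
    then have bv: "b \<in> vars n" using less.prems(1,2) vars_factor by blast
    have "total_deg b < total_deg (b * p)"
      using b0 prime_elem_not_unit[OF p(1)] by (intro total_deg_factor_less) auto
    then have lt: "total_deg b < total_deg a" by (simp add: b mult.commute)
    have "p dvd d * e" using less.prems(3) b by (metis dvd_def mult.assoc)
    then consider "p dvd d" | "p dvd e" using prime_elem_dvd_multD[OF p(1)] by blast
    then show ?thesis
    proof cases
      case 1
      then obtain d' where d': "d = p * d'" by (metis dvdE)
      have "p * (b * f) = p * (d' * e)" using less.prems(3) b d' by (simp add: mult.assoc)
      then have "b * f = d' * e" using b0(2) by simp
      then obtain a1 a2 f1 f2 where "b = a1 * a2" "f = f1 * f2" "d' = a1 * f1" "e = a2 * f2"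
        using less.hyps[OF lt bv b0(1)] by blast
      then show ?thesis using b d' by (metis mult.assoc)
    next
      case 2
      then obtain e' where e': "e = p * e'" by (metis dvdE)
      have "p * (b * f) = p * (d * e')" using less.prems(3) b e' by (simp add: mult_ac)
      then have "b * f = d * e'" using b0(2) by simp
      then obtain a1 a2 f1 f2 where *: "b = a1 * a2" "f = f1 * f2" "d = a1 * f1" "e' = a2 * f2"
        using less.hyps[OF lt bv b0(1)] by blast
      have "a = a1 * (p * a2)" "e = (p * a2) * f2" using b e' * by (simp_all add: mult_ac)
      then show ?thesis using * by blast
    qed
  qed
qed

text \<open>
  Division with remainder in \<open>R[x]\<close>, made possible by multiplying with a power of the leading
  coefficient of the divisor.  The point is that all coefficients stay in \<open>R\<close>.
\<close>

lemma pseudo_division: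
  fixes P F :: "('k::field) poly_nat poly"
  assumes P: "coeffs_in (vars n) P" "P \<noteq> 0" and F: "coeffs_in (vars n) F"
  shows "\<exists>k Q M. coeffs_in (vars n) Q \<and> coeffs_in (vars n) M \<and>
    smult (lead_coeff P ^ k) F = Q * P + M \<and> (M = 0 \<or> pdegree M < pdegree P)"
  using F
proof (induction "pdegree F" arbitrary: F rule: less_induct)
  case less
  show ?case
  proof (cases "F = 0 \<or> pdegree F < pdegree P")
    case True
    then show ?thesis using less.prems by (intro exI[of _ 0] exI[of _ 0] exI[of _ F]) simp
  next
    case False
    define t where "t = pmonom (lead_coeff F) (pdegree F - pdegree P)"
    define F' where "F' = smult (lead_coeff P) F - t * P"
    have t: "coeffs_in (vars n) t" using less.prems by (simp add: t_def)
    have F': "coeffs_in (vars n) F'"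
      unfolding F'_def using coeffs_in_mult[OF t P(1)] P(1) less.prems by simp
    have deg_tP: "pdegree (t * P) = pdegree F"
      using False P(2) by (simp add: t_def degree_mult_eq degree_monom_eq)
    have lead: "pcoeff F' (pdegree F) = 0"
      using False by (simp add: F'_def t_def coeff_monom_mult)
    have "pdegree F' \<le> pdegree F"
      unfolding F'_def by (intro degree_diff_le) (simp_all add: deg_tP)
    then have deg: "F' = 0 \<or> pdegree F' < pdegree F"
      using lead by (metis leading_coeff_0_iff order_le_imp_less_or_eq)
    have "\<exists>k Q M. coeffs_in (vars n) Q \<and> coeffs_in (vars n) M \<and>
        smult (lead_coeff P ^ k) F' = Q * P + M \<and> (M = 0 \<or> pdegree M < pdegree P)"
    proof (cases "F' = 0")
      case True
      then show ?thesis by (intro exI[of _ 0]) simp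
    next
      case False
      then show ?thesis using deg less.hyps F' by blast
    qed
    then obtain k Q M where Q: "coeffs_in (vars n) Q" "coeffs_in (vars n) M"
      "smult (lead_coeff P ^ k) F' = Q * P + M" "M = 0 \<or> pdegree M < pdegree P" by blast
    have "smult (lead_coeff P ^ Suc k) F = smult (lead_coeff P ^ k) (F' + t * P)"
      by (simp add: F'_def mult.commute)
    also have "\<dots> = (Q + smult (lead_coeff P ^ k) t) * P + M"
      using Q(3) by (simp add: smult_add_right distrib_right)
    finally have "smult (lead_coeff P ^ Suc k) F = (Q + smult (lead_coeff P ^ k) t) * P + M" .
    moreover have "coeffs_in (vars n) (Q + smult (lead_coeff P ^ k) t)"
      using Q(1) t P(1) by simp
    ultimately show ?thesis using Q(2,4) by blast
  qed
qed

text \<open>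
  A nonzero element of least degree in the ideal \<open>(f, g)\<close> is a common divisor of \<open>f\<close> and \<open>g\<close> up to
  factors from \<open>R\<close>.  Over the fraction field of \<open>R\<close> it would be their greatest common divisor.
\<close>

lemma common_divisor_up_to_constants:
  fixes f g :: "('k::field) poly_nat"
  assumes f: "f \<in> vars (Suc n)" "f \<noteq> 0" and g: "g \<in> vars (Suc n)"
  obtains u v a b where "a \<in> vars n" "a \<noteq> 0" "u * f + v * g dvd a * f"
    "b \<in> vars n" "b \<noteq> 0" "u * f + v * g dvd b * g"
proof -
  define good where "good P \<longleftrightarrow> P \<noteq> 0 \<and> coeffs_in (vars n) P \<and>
    (\<exists>u v. poly P (coord n) = u * f + v * g)" for P
  obtain F where F: "coeffs_in (vars n) F" "poly F (coord n) = f" using f(1) by (rule vars_Suc_as_poly)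
  obtain G where G: "coeffs_in (vars n) G" "poly G (coord n) = g" using g by (rule vars_Suc_as_poly)
  have "F \<noteq> 0" using F f(2) by auto
  then have "good F" unfolding good_def using F by (intro conjI exI[of _ 1] exI[of _ 0]) auto
  then obtain P where P: "good P" "\<And>M. good M \<Longrightarrow> pdegree P \<le> pdegree M"
    using ex_has_least_nat[of good F pdegree] by blast
  obtain u v where uv: "poly P (coord n) = u * f + v * g" using P(1) by (auto simp: good_def)
  have P0: "P \<noteq> 0" "coeffs_in (vars n) P" using P(1) by (auto simp: good_def)
  have div: "\<exists>a \<in> vars n. a \<noteq> 0 \<and> poly P (coord n) dvd a * h"
    if H: "coeffs_in (vars n) H" "poly H (coord n) = h" and h: "h = s * f + t * g" for H h s t
  proof -
    obtain k Q M where Q: "coeffs_in (vars n) Q" "coeffs_in (vars n) M"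
      "smult (lead_coeff P ^ k) H = Q * P + M" "M = 0 \<or> pdegree M < pdegree P"
      using pseudo_division[OF P0(2,1) H(1)] by blast
    let ?a = "lead_coeff P ^ k"
    have eq: "?a * h = poly Q (coord n) * poly P (coord n) + poly M (coord n)"
      using arg_cong[OF Q(3), of "\<lambda>P. poly P (coord n)"] H(2) by simp
    have "poly M (coord n) = ?a * h - poly Q (coord n) * poly P (coord n)" using eq by simp
    also have "\<dots> = (?a * s - poly Q (coord n) * u) * f + (?a * t - poly Q (coord n) * v) * g"
      unfolding h uv by (simp add: algebra_simps)
    finally have "M = 0" using P(2)[of M] Q(2,4) unfolding good_def by (metis not_le)
    then have "poly P (coord n) dvd ?a * h" using eq by simp
    moreover have "?a \<in> vars n" "?a \<noteq> 0" using P0 by simp_all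
    ultimately show ?thesis by blast
  qed
  obtain a where "a \<in> vars n" "a \<noteq> 0" "poly P (coord n) dvd a * f"
    using div[OF F, of 1 0] by auto
  moreover obtain b where "b \<in> vars n" "b \<noteq> 0" "poly P (coord n) dvd b * g"
    using div[OF G, of 0 1] by auto
  ultimately show ?thesis using that unfolding uv by blast
qed

text \<open>
  Gauss's lemma.  An irreducible \<open>f\<close> outside \<open>R\<close> shares only units as factors with a nonzero \<open>c\<close>
  from \<open>R\<close>, so \<open>f\<close> divides \<open>k\<close> whenever it divides \<open>c k\<close>.  Let \<open>d = u f + v g\<close> be a common divisor of \<open>f\<close>
  and \<open>g\<close> up to constants.  By irreducibility either \<open>f\<close> divides \<open>d\<close>, and then it divides \<open>g\<close> up to a
  constant, or \<open>d\<close> itself is constant up to a unit, and then \<open>d h\<close>, which is a multiple of \<open>f\<close> if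
  \<open>g h\<close> is one, shows that \<open>f\<close> divides \<open>h\<close>.
\<close>

lemma irreducible_imp_prime_in_vars_Suc:
  fixes f :: "('k::field) poly_nat"
  assumes R: "has_prime_divisors (vars n :: 'k poly_nat set)"
    and f: "f \<in> vars (Suc n)" "Factorial_Ring.irreducible f" "f \<notin> vars n"
  shows "prime_in (vars (Suc n)) f"
  unfolding prime_in_def
proof (intro conjI ballI impI)
  show f0: "f \<noteq> 0" and "\<not> f dvd 1" using f(2) by (auto simp: Factorial_Ring.irreducible_def)
  fix g h :: "'k poly_nat"
  assume g: "g \<in> vars (Suc n)" and h: "h \<in> vars (Suc n)" and dvd: "f dvd g * h"
  have assoc: "f dvd c * k \<Longrightarrow> f dvd k" if c: "c \<in> vars n" "c \<noteq> 0" for c k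
  proof -
    assume "f dvd c * k"
    then obtain e where "c * k = f * e" by (metis dvdE)
    then obtain c1 c2 k1 k2 where *: "c = c1 * c2" "k = k1 * k2" "f = c1 * k1" "e = c2 * k2"
      using refine_factorizations[OF R c] by blast
    have "c1 \<in> vars n" using c * vars_factor[of c n c1] by auto
    have "\<not> k1 dvd 1"
    proof
      assume "k1 dvd 1"
      then obtain i where "1 = k1 * i" by (metis dvdE)
      then have "c1 = f * i" using *(3) by (simp add: mult.assoc)
      moreover have "c1 \<noteq> 0" using f0 *(3) by auto
      ultimately have "f \<in> vars n" using \<open>c1 \<in> vars n\<close> vars_factor[of c1 n f] by simp
      then show False using f(3) by simp
    qed
    then have "c1 dvd 1" using f(2) *(3) irreducibleD by blast
    then obtain i where "1 = c1 * i" by (metis dvdE)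
    then have "k1 = f * i" using *(3) by (simp add: mult_ac)
    then show "f dvd k" using *(2) by simp
  qed
  obtain u v a b where a: "a \<in> vars n" "a \<noteq> 0" "u * f + v * g dvd a * f"
    and b: "b \<in> vars n" "b \<noteq> 0" "u * f + v * g dvd b * g"
    by (rule common_divisor_up_to_constants[OF f(1) f0 g])
  define d where "d = u * f + v * g"
  obtain e where e: "a * f = d * e" using a(3) unfolding d_def by (metis dvdE)
  then obtain a1 a2 f1 f2 where *: "a = a1 * a2" "f = f1 * f2" "d = a1 * f1" "e = a2 * f2"
    using refine_factorizations[OF R a(1,2)] by blast
  have a1: "a1 \<in> vars n" "a1 \<noteq> 0" using a * vars_factor[of a n a1] by auto
  from f(2) *(2) consider "f1 dvd 1" | "f2 dvd 1" using irreducibleD by blast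
  then show "f dvd g \<or> f dvd h"
  proof cases
    case 1
    then obtain i where i: "1 = f1 * i" by (metis dvdE)
    have "f dvd f * (u * h) + v * (g * h)" by (intro dvd_add dvd_triv_left dvd_mult[OF dvd])
    also have "f * (u * h) + v * (g * h) = d * h" by (simp add: d_def algebra_simps)
    also have "\<dots> = a1 * f1 * h" by (simp only: *(3))
    finally have "f dvd a1 * (f1 * h)" by (simp add: mult.assoc)
    then have "f dvd f1 * h" using assoc a1 by blast
    then have "f dvd i * (f1 * h)" by simp
    also have "i * (f1 * h) = h" using i by (metis mult.assoc mult.commute mult_1)
    finally show ?thesis by simp
  next
    case 2
    then obtain i where i: "1 = f2 * i" by (metis dvdE)
    have "f1 = f * i" using i *(2) by (metis mult.assoc mult.right_neutral)
    then have "f dvd d" using *(3) by simp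
    then have "f dvd b * g" using b(3) unfolding d_def by (rule dvd_trans)
    then show ?thesis using assoc b by blast
  qed
qed

lemma irreducible_divisor_exists:
  fixes a :: "('k::field) poly_nat"
  assumes "a \<noteq> 0" "\<not> a dvd 1"
  shows "\<exists>f. Factorial_Ring.irreducible f \<and> f dvd a"
  using assms
proof (induction "total_deg a" arbitrary: a rule: less_induct)
  case less
  show ?case
  proof (cases "Factorial_Ring.irreducible a")
    case False
    then obtain b c where bc: "a = b * c" "\<not> b dvd 1" "\<not> c dvd 1"
      using less.prems by (auto simp: Factorial_Ring.irreducible_def)
    then have "total_deg b < total_deg a" using less.prems(1) by (auto intro: total_deg_factor_less)
    then obtain f where "Factorial_Ring.irreducible f" "f dvd b"
      using less.hyps[of b] bc less.prems(1) by auto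
    then show ?thesis using bc(1) by (metis dvd_mult2)
  qed auto
qed

text \<open>
  In the inductive step, an irreducible divisor either lies in the smaller ring, where the induction
  hypothesis applies, or is prime by Gauss's lemma.
\<close>

lemma has_prime_divisors_vars: "has_prime_divisors (vars n :: ('k::field) poly_nat set)"
proof (induction n)
  case 0
  have "a dvd 1" if a: "a \<in> vars 0" "a \<noteq> 0" for a :: "'k poly_nat"
  proof -
    have "\<forall>m \<in> Poly_Mapping.keys a. total_degree m = 0"
      using a(1) by (auto simp: vars_def total_degree_def)
    then have "total_deg a = 0" by (simp only: degree_grading_eq_0_iff)
    then show ?thesis using total_deg_eq_0_iff[OF a(2)] by blast
  qed
  then show ?case by blast
next
  case (Suc n)
  show ?case
  proof (intro ballI impI)
    fix a :: "'k poly_nat"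
    assume a: "a \<in> vars (Suc n)" "a \<noteq> 0" "\<not> a dvd 1"
    obtain f where f: "Factorial_Ring.irreducible f" "f dvd a"
      using irreducible_divisor_exists[OF a(2,3)] by blast
    have fv: "f \<in> vars (Suc n)" using vars_factor[OF a(1,2) f(2)] .
    show "\<exists>p. prime_elem p \<and> p dvd a"
    proof (cases "f \<in> vars n")
      case True
      then obtain p where "prime_elem p" "p dvd f"
        using Suc irreducible_not_unit[OF f(1)] f(1) by (metis not_irreducible_zero)
      then show ?thesis using f(2) dvd_trans by blast
    next
      case False
      then have "prime_elem f"
        using irreducible_imp_prime_in_vars_Suc[OF Suc fv f(1)] prime_in_vars_imp_prime_elem[OF fv] by blast
      then show ?thesis using f(2) by blast
    qed
  qed
qed

lemma prime_divisor_exists: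
  fixes a :: "('k::field) poly_nat"
  assumes "a \<noteq> 0" "\<not> a dvd 1"
  obtains p where "prime_elem p" "p dvd a"
proof -
  obtain n where "a \<in> vars n" using vars_exhaust by blast
  then show ?thesis using has_prime_divisors_vars[of n] assms that by blast
qed

section \<open>Factors of forms\<close>

text \<open>
  The order of vanishing at \<open>0\<close> and the degree are both additive and agree on \<open>p q\<close>; as the former
  never exceeds the latter, they agree on \<open>p\<close>.
\<close>

lemma monomial_factor:
  fixes p q :: "'a::idom poly"
  assumes "p * q = pmonom c n" "c \<noteq> 0"
  shows "p = pmonom (lead_coeff p) (pdegree p)"
proof -
  have 0: "p * q \<noteq> 0" using assms by simp
  then have nz: "p \<noteq> 0" "q \<noteq> 0" by auto
  have "order 0 p + order 0 q = pdegree p + pdegree q"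
    using order_mult[OF 0, of 0] degree_mult_eq[OF nz] assms by (simp add: degree_monom_eq)
  then have "order 0 p = pdegree p"
    using order_degree[OF nz(1), of 0] order_degree[OF nz(2), of 0] by linarith
  then have "pmonom 1 (pdegree p) dvd p" using monom_1_dvd_iff[OF nz(1)] by simp
  then have "\<forall>k<pdegree p. pcoeff p k = 0" by (simp add: monom_1_dvd_iff')
  then show ?thesis by (intro poly_eqI) (metis coeff_monom coeff_eq_0 linorder_neqE_nat)
qed

lemma forms_iff_grading:
  "f \<in> forms r d \<longleftrightarrow> f \<in> vars (Suc r) \<and> grading total_degree f = pmonom f d"
proof -
  have "(\<forall>m \<in> Poly_Mapping.keys f. total_degree m = d) \<longleftrightarrow> grading total_degree f = pmonom f d"
  proof
    assume *: "\<forall>m \<in> Poly_Mapping.keys f. total_degree m = d"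
    show "grading total_degree f = pmonom f d"
    proof (rule grading_eqI)
      fix e m
      show "Poly_Mapping.lookup (pcoeff (pmonom f d) e) m =
          (if total_degree m = e then Poly_Mapping.lookup f m else 0)"
        using * by (cases "m \<in> Poly_Mapping.keys f") (auto simp: in_keys_iff)
    qed
  next
    assume *: "grading total_degree f = pmonom f d"
    show "\<forall>m \<in> Poly_Mapping.keys f. total_degree m = d"
    proof
      fix m assume "m \<in> Poly_Mapping.keys f"
      then have "Poly_Mapping.lookup (pcoeff (pmonom f d) (total_degree m)) m \<noteq> 0"
        using lookup_coeff_grading[of total_degree f "total_degree m" m] * by (simp add: in_keys_iff)
      then show "total_degree m = d" by (auto split: if_splits)
    qed
  qed
  then show ?thesis by (simp add: forms_def carrier_coord_ring)
qed

lemma form_factor: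
  assumes F: "F \<in> forms r d" "F \<noteq> 0" and g: "g dvd F"
  shows "g \<in> all_forms r"
proof -
  obtain h where h: "F = g * h" using g by (metis dvdE)
  have "grading total_degree g * grading total_degree h = pmonom F d"
    using F(1) grading_mult[where w = total_degree and f = g and g = h] total_degree_add
    by (simp add: h forms_iff_grading)
  then obtain c e where g': "grading total_degree g = pmonom c e"
    using monomial_factor F(2) by metis
  have "c = g" using arg_cong[OF g', of "\<lambda>p. poly p 1"] by (simp add: poly_monom)
  moreover have "g \<in> vars (Suc r)" using F g by (auto simp: forms_iff_grading intro: vars_factor)
  ultimately have "g \<in> forms r e" using g' by (simp add: forms_iff_grading)
  then show ?thesis by (auto simp: all_forms_def)
qed

section \<open>Sets of pairwise non-associate primes\<close>

lemma prime_elem_dvd_prod: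
  fixes p :: "'a::comm_semiring_1"
  assumes "prime_elem p" "finite A" "p dvd \<Prod>A"
  shows "\<exists>q \<in> A. p dvd q"
  using assms(2,3)
proof (induction A)
  case empty
  then show ?case using assms(1) by (simp add: prime_elem_not_unit)
next
  case (insert q A)
  then show ?case using prime_elem_dvd_multD[OF assms(1)] by auto
qed

definition nonassociate_primes :: "'a::comm_semiring_1 set \<Rightarrow> bool" where
  "nonassociate_primes M \<longleftrightarrow> finite M \<and> (\<forall>p \<in> M. prime_elem p) \<and> (\<forall>p \<in> M. \<forall>q \<in> M. p dvd q \<longrightarrow> p = q)"

lemma nonassociate_primes_subset:
  "nonassociate_primes M \<Longrightarrow> N \<subseteq> M \<Longrightarrow> nonassociate_primes N"
  unfolding nonassociate_primes_def by (meson finite_subset subset_iff)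

lemma prime_dvd_prod_iff:
  assumes "nonassociate_primes M" "N \<subseteq> M" "p \<in> M"
  shows "p dvd \<Prod>N \<longleftrightarrow> p \<in> N"
proof
  have N: "finite N" "\<forall>q \<in> N. p dvd q \<longrightarrow> p = q" and p: "prime_elem p"
    using assms finite_subset[of N M] by (auto simp: nonassociate_primes_def)
  show "p dvd \<Prod>N \<Longrightarrow> p \<in> N" using prime_elem_dvd_prod[OF p N(1)] N(2) by blast
  show "p \<in> N \<Longrightarrow> p dvd \<Prod>N" using N(1) by (simp add: dvd_prod_eqI)
qed

text \<open>
  This is the statement that the kernel of \<open>S \<rightarrow> \<Prod>\<^sub>p S / p\<close> is generated by the product of the primes.
\<close>

lemma prod_primes_dvd:
  fixes M :: "'a::idom set"
  assumes "nonassociate_primes M" "\<And>p. p \<in> M \<Longrightarrow> p dvd g"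
  shows "\<Prod>M dvd g"
proof -
  have "\<Prod>N dvd g" if "finite N" "N \<subseteq> M" for N
    using that
  proof (induction N)
    case (insert p N)
    then obtain k where k: "g = \<Prod>N * k" by (auto elim: dvdE)
    have "p \<in> M" "N \<subseteq> M" using insert.prems by auto
    then have "\<not> p dvd \<Prod>N" using prime_dvd_prod_iff[OF assms(1)] insert.hyps by blast
    moreover have "p dvd \<Prod>N * k" "prime_elem p"
      using assms \<open>p \<in> M\<close> k by (auto simp: nonassociate_primes_def)
    ultimately have "p dvd k" using prime_elem_dvd_multD by blast
    then show ?case using k insert.hyps by (auto simp: mult.commute intro: mult_dvd_mono)
  qed simp
  then show ?thesis using assms(1) by (simp add: nonassociate_primes_def)
qed

text \<open>
  Split off one prime at a time.  A prime associate to one that was split off earlier would make a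
  square divide \<open>F\<close>.
\<close>

lemma squarefree_prime_factorization:
  fixes F :: "('k::field) poly_nat"
  assumes "F \<noteq> 0" "\<And>p. prime_elem p \<Longrightarrow> \<not> p * p dvd F"
  shows "\<exists>M. nonassociate_primes M \<and> F dvd \<Prod>M \<and> \<Prod>M dvd F"
  using assms
proof (induction "total_deg F" arbitrary: F rule: less_induct)
  case less
  show ?case
  proof (cases "F dvd 1")
    case True
    then show ?thesis by (intro exI[of _ "{}"]) (simp add: nonassociate_primes_def)
  next
    case False
    then obtain p where p: "prime_elem p" "p dvd F"
      using prime_divisor_exists less.prems(1) by blast
    obtain b where b: "F = p * b" using p(2) by (metis dvdE)
    have b0: "b \<noteq> 0" using b less.prems(1) by auto
    have "total_deg b < total_deg (b * p)"
      using b0 p(1) prime_elem_not_unit[OF p(1)] b less.prems(1) by (intro total_deg_factor_less) auto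
    then have lt: "total_deg b < total_deg F" by (simp add: b mult.commute)
    have sq: "\<not> q * q dvd b" if "prime_elem q" for q
      using less.prems(2)[OF that] b by auto
    obtain M where M: "nonassociate_primes M" "b dvd \<Prod>M" "\<Prod>M dvd b"
      using less.hyps[OF lt b0] sq by blast
    have fin: "finite M" and primes: "\<And>q. q \<in> M \<Longrightarrow> prime_elem q"
      using M(1) by (auto simp: nonassociate_primes_def)
    have dvd_b: "q dvd b" if "q \<in> M" for q
      using that fin M(3) dvd_trans by (metis dvd_prod_eqI)
    have notdvd: "\<not> p dvd q" "\<not> q dvd p" if "q \<in> M" for q
    proof -
      show "\<not> q dvd p"
        using less.prems(2)[OF primes[OF that]] dvd_b[OF that] unfolding b by (meson mult_dvd_mono)
      show "\<not> p dvd q"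
        using less.prems(2)[OF p(1)] dvd_b[OF that] unfolding b by (meson mult_dvd_mono dvd_refl dvd_trans)
    qed
    have "p \<notin> M" using notdvd(1)[of p] by auto
    have "nonassociate_primes (insert p M)"
      using M(1) p(1) notdvd unfolding nonassociate_primes_def by blast
    moreover have "\<Prod>(insert p M) = p * \<Prod>M" using fin \<open>p \<notin> M\<close> by simp
    ultimately show ?thesis using M(2,3) b by (metis dvd_refl mult_dvd_mono)
  qed
qed

section \<open>Principal ideals of the coordinate ring\<close>

abbreviation pideal :: "nat \<Rightarrow> ('k::field) poly_nat \<Rightarrow> 'k poly_nat set" where
  "pideal r f \<equiv> PIdl\<^bsub>coord_ring r\<^esub> f"

text \<open>
  Reduces membership in a principal ideal of \<open>S\<close> to divisibility in the ambient ring.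
\<close>

lemma mem_pideal_iff:
  assumes "f \<in> vars (Suc r)"
  shows "g \<in> pideal r f \<longleftrightarrow> g \<in> vars (Suc r) \<and> f dvd g"
proof
  assume "g \<in> pideal r f"
  then obtain h where "h \<in> vars (Suc r)" "g = h * f"
    unfolding cgenideal_def carrier_coord_ring by (auto simp: coord_ring_def)
  then show "g \<in> vars (Suc r) \<and> f dvd g" using assms by simp
next
  assume g: "g \<in> vars (Suc r) \<and> f dvd g"
  then obtain h where h: "g = h * f" by (metis dvdE mult.commute)
  have "\<exists>h \<in> vars (Suc r). g = h * f"
  proof (cases "g = 0")
    case True
    then show ?thesis by (intro bexI[of _ 0]) simp_all
  next
    case False
    then show ?thesis using vars_factor[of g "Suc r" h] g h by auto
  qed
  then show "g \<in> pideal r f"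
    unfolding cgenideal_def carrier_coord_ring by (auto simp: coord_ring_def)
qed

lemma ideal_pideal: "f \<in> vars (Suc r) \<Longrightarrow> ideal (pideal r f) (coord_ring r)"
  by (intro cring.cgenideal_ideal cring_coord_ring) (simp add: carrier_coord_ring)

lemma pideal_subset_ideal:
  assumes "ideal P (coord_ring r)" "f \<in> P"
  shows "pideal r f \<subseteq> P"
  using ring.cgenideal_minimal[OF cring.axioms(1)[OF cring_coord_ring] assms] .

lemma primeideal_pideal:
  assumes f: "f \<in> vars (Suc r)" "prime_elem f"
  shows "primeideal (pideal r f) (coord_ring r)"
proof (rule primeidealI[OF ideal_pideal[OF f(1)] cring_coord_ring])
  show "carrier (coord_ring r) \<noteq> pideal r f"
    using mem_pideal_iff[OF f(1), of 1] prime_elem_not_unit[OF f(2)] vars_1 carrier_coord_ring by metis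
  fix a b
  assume "a \<in> carrier (coord_ring r)" "b \<in> carrier (coord_ring r)"
    "a \<otimes>\<^bsub>coord_ring r\<^esub> b \<in> pideal r f"
  then show "a \<in> pideal r f \<or> b \<in> pideal r f"
    unfolding mem_pideal_iff[OF f(1)] carrier_coord_ring
    using prime_elem_dvd_multD[OF f(2), of a b] by (auto simp: coord_ring_def)
qed

lemma all_forms_vars: "f \<in> all_forms r \<Longrightarrow> f \<in> vars (Suc r)"
  by (auto simp: all_forms_def forms_iff_grading)

lemma homogeneous_pideal:
  assumes f: "f \<in> all_forms r"
  shows "homogeneous_ideal r (pideal r f)"
proof -
  interpret cring "coord_ring r" by (rule cring_coord_ring)
  let ?I = "pideal r f"
  have fv: "f \<in> vars (Suc r)" using f by (rule all_forms_vars)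
  have I: "ideal ?I (coord_ring r)" using fv by (rule ideal_pideal)
  have sub: "?I \<inter> all_forms r \<subseteq> carrier (coord_ring r)"
    by (auto simp: carrier_coord_ring all_forms_vars)
  have "f \<in> ?I \<inter> all_forms r" using f fv by (simp add: mem_pideal_iff)
  then have "f \<in> Idl\<^bsub>coord_ring r\<^esub> (?I \<inter> all_forms r)" using genideal_self[OF sub] by blast
  then have "?I \<subseteq> Idl\<^bsub>coord_ring r\<^esub> (?I \<inter> all_forms r)"
    by (intro pideal_subset_ideal genideal_ideal sub)
  moreover have "Idl\<^bsub>coord_ring r\<^esub> (?I \<inter> all_forms r) \<subseteq> ?I"
    by (rule genideal_minimal[OF I]) simp
  ultimately show ?thesis unfolding homogeneous_ideal_def using I by blast
qed

lemma prod_in_primeideal: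
  assumes P: "primeideal P (coord_ring r)" and "finite M" "M \<subseteq> vars (Suc r)" "\<Prod>M \<in> P"
  shows "\<exists>f \<in> M. f \<in> P"
  using assms(2-)
proof (induction M)
  case empty
  interpret primeideal P "coord_ring r" by (rule P)
  have "P = carrier (coord_ring r)"
    using empty one_imp_carrier by (simp add: coord_ring_def)
  then show ?case using I_notcarr by blast
next
  case (insert f M)
  have "f \<otimes>\<^bsub>coord_ring r\<^esub> \<Prod>M \<in> P" using insert by (simp add: coord_ring_def)
  moreover have "\<Prod>M \<in> vars (Suc r)" using insert.prems by (intro vars_prod) auto
  ultimately have "f \<in> P \<or> \<Prod>M \<in> P"
    using primeideal.I_prime[OF P] insert.prems by (simp add: carrier_coord_ring)
  then show ?case using insert by auto
qed

section \<open>Components of a hypersurface\<close>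

lemma irreducible_in_finite_Union:
  assumes "irreducible_in T W" "finite \<C>" "\<And>C. C \<in> \<C> \<Longrightarrow> closedin T C" "W \<subseteq> \<Union>\<C>"
  shows "\<exists>C \<in> \<C>. W \<subseteq> C"
  using assms(2-)
proof (induction \<C>)
  case empty
  then show ?case using assms(1) by (auto simp: irreducible_in_def)
next
  case (insert C \<C>)
  have "closedin T C" "closedin T (\<Union>\<C>)" using insert by (auto intro: closedin_Union)
  then have "W \<subseteq> C \<or> W \<subseteq> \<Union>\<C>"
    using assms(1) insert.prems(2) unfolding irreducible_in_def by auto
  then show ?case using insert by auto
qed

lemma zero_locus_pideal:
  assumes "f \<in> vars (Suc r)"
  shows "zero_locus r (pideal r f) = {P \<in> proj_space r. f \<in> P}"
proof -
  have "pideal r f \<subseteq> P \<longleftrightarrow> f \<in> P" if "P \<in> proj_space r" for P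
  proof
    show "f \<in> P \<Longrightarrow> pideal r f \<subseteq> P"
      using that by (intro pideal_subset_ideal) (simp_all add: proj_space_def homogeneous_ideal_def)
    show "pideal r f \<subseteq> P \<Longrightarrow> f \<in> P"
      using assms by (auto simp: mem_pideal_iff)
  qed
  then show ?thesis by (auto simp: zero_locus_def)
qed

text \<open>
  What has to be excluded is that \<open>f\<close> divides all coordinates.  In that case every coordinate would
  multiply \<open>F / f\<close> into \<open>(F)\<close>, so that \<open>F / f\<close> would lie in \<open>(F)\<close> by saturation, and \<open>f\<close> would be a
  unit.
\<close>

lemma prime_factor_in_proj_space:
  assumes F: "F \<in> all_forms r" "F \<noteq> 0" and sat: "saturated r (pideal r F)"
    and f: "prime_elem f" "f dvd F"
  shows "pideal r f \<in> proj_space r"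
proof -
  have Fv: "F \<in> vars (Suc r)" using F(1) by (rule all_forms_vars)
  have form: "f \<in> all_forms r" using F f(2) form_factor by (auto simp: all_forms_def)
  then have fv: "f \<in> vars (Suc r)" by (rule all_forms_vars)
  obtain G where G: "F = f * G" using f(2) by (metis dvdE)
  have Gv: "G \<in> vars (Suc r)" using vars_factor[OF Fv F(2)] G by auto
  have "\<exists>i\<le>r. coord i \<notin> pideal r f"
  proof (rule ccontr)
    assume "\<not> ?thesis"
    then have "f dvd coord i" if "i \<le> r" for i using that fv by (auto simp: mem_pideal_iff)
    then have "F dvd coord i ^ 1 * G" if "i \<le> r" for i
      using that unfolding G by (simp add: mult_dvd_mono)
    moreover have "coord i ^ 1 * G \<in> vars (Suc r)" if "i \<le> r" for i
      using that Gv by (intro vars_mult vars_power coord_in_vars) auto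
    ultimately have "\<forall>i\<le>r. \<exists>m. coord i ^ m * G \<in> pideal r F"
      using mem_pideal_iff[OF Fv] by blast
    then have "G \<in> pideal r F"
      using sat Gv unfolding saturated_def carrier_coord_ring by blast
    then have "f * G dvd 1 * G" using Fv G by (simp add: mem_pideal_iff)
    moreover have "G \<noteq> 0" using G F(2) by auto
    ultimately have "f dvd 1" unfolding dvd_mult_cancel_right by blast
    then show False using prime_elem_not_unit[OF f(1)] by blast
  qed
  then show ?thesis
    using primeideal_pideal[OF fv f(1)] homogeneous_pideal[OF form] by (simp add: proj_space_def)
qed

text \<open>
  If \<open>F = p\<^sup>2 H\<close>, then the square of the form \<open>p H\<close> lies in \<open>(F)\<close>.  Reducedness gives that \<open>p H\<close>
  vanishes on \<open>X\<close> on every affine chart, and saturation that it lies in \<open>(F)\<close>.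
\<close>

lemma reduced_hypersurface_squarefree:
  assumes F: "F \<in> all_forms r" "F \<noteq> 0" and red: "reduced_subscheme r (pideal r F)"
    and p: "prime_elem p"
  shows "\<not> p * p dvd F"
proof
  assume "p * p dvd F"
  then obtain H where H: "F = p * p * H" by (metis dvdE)
  have Fv: "F \<in> vars (Suc r)" using F(1) by (rule all_forms_vars)
  have "p * H dvd F" by (simp add: H mult.assoc)
  then have form: "p * H \<in> all_forms r" using F form_factor by (auto simp: all_forms_def)
  then have v: "p * H \<in> vars (Suc r)" by (rule all_forms_vars)
  have "F dvd (p * H) ^ 2" by (simp add: H power2_eq_square mult_ac)
  then have "coord i ^ 0 * (p * H) ^ 2 \<in> pideal r F" for i
    using v by (simp add: mem_pideal_iff[OF Fv])
  then have "\<forall>i\<le>r. \<exists>m. coord i ^ m * (p * H) \<in> pideal r F"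
    using red form unfolding reduced_subscheme_def by blast
  moreover have "saturated r (pideal r F)"
    using red by (simp add: reduced_subscheme_def closed_subscheme_def)
  ultimately have "p * H \<in> pideal r F"
    using v unfolding saturated_def carrier_coord_ring by blast
  then have "p * (p * H) dvd 1 * (p * H)" using Fv by (simp add: mem_pideal_iff H mult.assoc)
  moreover have "p * H \<noteq> 0" using F(2) H by auto
  ultimately have "p dvd 1" unfolding dvd_mult_cancel_right by blast
  then show False using prime_elem_not_unit[OF p] by blast
qed

text \<open>
  Each prime factor \<open>f\<close> of \<open>F\<close> yields a point \<open>(f)\<close> of \<open>X\<close> that is dense in the zero locus of \<open>f\<close>.
  Hence this locus is irreducible, and \<open>(f)\<close> is recovered as its vanishing ideal.  The finitely many
  loci cover \<open>X\<close>, so every irreducible set lies in one of them, and none contains another, because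
  the primes are not associate.
\<close>

lemma component_subschemes_hypersurface:
  fixes F :: "('k::field) poly_nat"
  assumes F: "F \<in> all_forms r" "F \<noteq> 0" and sat: "saturated r (pideal r F)"
    and M: "nonassociate_primes M" "F dvd \<Prod>M" "\<Prod>M dvd F"
  shows "component_subschemes r (pideal r F) = pideal r ` M"
proof -
  define T where "T = subtopology (zariski_topology r) (zero_locus r (pideal r F))"
  define V where "V = (\<lambda>f :: 'k poly_nat. zero_locus r (pideal r f))"
  have Fv: "F \<in> vars (Suc r)" using F(1) by (rule all_forms_vars)
  have fin: "finite M" and prime: "\<And>f. f \<in> M \<Longrightarrow> prime_elem f"
    using M(1) by (auto simp: nonassociate_primes_def)
  have dvdF: "f dvd F" if "f \<in> M" for f using that fin M(3) by (metis dvd_prod_eqI dvd_trans)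
  have form: "f \<in> all_forms r" if "f \<in> M" for f
    using dvdF[OF that] F form_factor by (auto simp: all_forms_def)
  have fv: "f \<in> vars (Suc r)" if "f \<in> M" for f using form[OF that] by (rule all_forms_vars)
  have point: "pideal r f \<in> V f" if "f \<in> M" for f
    using prime_factor_in_proj_space[OF F sat prime dvdF] that fv
    by (simp add: V_def zero_locus_pideal mem_pideal_iff)
  have V_sub: "V f \<subseteq> zero_locus r (pideal r F)" if "f \<in> M" for f
  proof -
    have "F \<in> pideal r f" using fv[OF that] Fv dvdF[OF that] by (simp add: mem_pideal_iff)
    then have "pideal r F \<subseteq> pideal r f" by (intro pideal_subset_ideal ideal_pideal fv that)
    then show ?thesis by (auto simp: V_def zero_locus_def)
  qed
  have cover: "zero_locus r (pideal r F) \<subseteq> \<Union>(V ` M)"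
  proof
    fix P assume P: "P \<in> zero_locus r (pideal r F)"
    then have PP: "P \<in> proj_space r" "F \<in> P" using Fv by (simp_all add: zero_locus_pideal)
    then have pr: "primeideal P (coord_ring r)" by (simp add: proj_space_def)
    have "\<Prod>M \<in> pideal r F" using M(2) fv by (simp add: mem_pideal_iff Fv vars_prod)
    then have "\<Prod>M \<in> P" using P by (auto simp: zero_locus_def)
    then obtain f where "f \<in> M" "f \<in> P" using prod_in_primeideal[OF pr fin] fv by blast
    then show "P \<in> \<Union>(V ` M)" using PP(1) fv by (auto simp: V_def zero_locus_pideal)
  qed
  have topspace: "topspace T = zero_locus r (pideal r F)"
    by (auto simp: T_def topspace_zariski zero_locus_def)
  have closed: "closedin T C \<longleftrightarrow>
      (\<exists>E \<subseteq> all_forms r. C = zero_locus r E \<inter> zero_locus r (pideal r F))" for C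
    by (auto simp: T_def closedin_subtopology closedin_zariski)
  have V_closed: "closedin T (V f)" if "f \<in> M" for f
  proof -
    have "V f = zero_locus r {f}"
      using fv[OF that] by (auto simp: V_def zero_locus_pideal) (auto simp: zero_locus_def)
    then have "V f = zero_locus r {f} \<inter> zero_locus r (pideal r F)" using V_sub[OF that] by blast
    then show ?thesis unfolding closed using form[OF that] by blast
  qed
  have V_irr: "irreducible_in T (V f)" if f: "f \<in> M" for f
    unfolding irreducible_in_def
  proof (intro conjI allI impI)
    show "V f \<subseteq> topspace T" using V_sub[OF f] topspace by simp
    show "V f \<noteq> {}" using point[OF f] by blast
    have gen: "V f \<subseteq> C" if "closedin T C" "pideal r f \<in> C" for C
    proof -
      obtain E where E: "C = zero_locus r E \<inter> zero_locus r (pideal r F)"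
        using iffD1[OF closed \<open>closedin T C\<close>] by auto
      then have "E \<subseteq> pideal r f" using that(2) by (simp add: zero_locus_def)
      then have "V f \<subseteq> zero_locus r E" by (auto simp: V_def zero_locus_def)
      then show ?thesis using V_sub[OF f] E by blast
    qed
    fix C D assume "closedin T C \<and> closedin T D \<and> V f \<subseteq> C \<union> D"
    then show "V f \<subseteq> C \<or> V f \<subseteq> D" using gen point[OF f] by blast
  qed
  have V_max: "\<exists>f \<in> M. W \<subseteq> V f" if W: "irreducible_in T W" for W
  proof -
    have "W \<subseteq> \<Union>(V ` M)" using W cover topspace unfolding irreducible_in_def by blast
    then show ?thesis using irreducible_in_finite_Union[OF W, of "V ` M"] fin V_closed by blast
  qed
  have V_inj: "f = g" if "f \<in> M" "g \<in> M" "V f \<subseteq> V g" for f g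
  proof -
    have "g \<in> pideal r f" using point[OF that(1)] that(3) fv[OF that(2)]
      by (auto simp: V_def zero_locus_pideal)
    then have "f dvd g" using fv that by (simp add: mem_pideal_iff)
    then show ?thesis using M(1) that by (auto simp: nonassociate_primes_def)
  qed
  have "irreducible_components T = V ` M"
  proof
    show "irreducible_components T \<subseteq> V ` M"
    proof
      fix Z assume "Z \<in> irreducible_components T"
      then have Z: "irreducible_in T Z" "\<And>W. irreducible_in T W \<Longrightarrow> Z \<subseteq> W \<Longrightarrow> W = Z"
        by (auto simp: irreducible_components_def)
      obtain f where "f \<in> M" "Z \<subseteq> V f" using V_max[OF Z(1)] by blast
      then show "Z \<in> V ` M" using Z(2)[OF V_irr] by blast
    qed
    show "V ` M \<subseteq> irreducible_components T"
    proof
      fix Z assume "Z \<in> V ` M"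
      then obtain f where f: "f \<in> M" "Z = V f" by blast
      have "W = V f" if W: "irreducible_in T W" "V f \<subseteq> W" for W
      proof -
        obtain g where g: "g \<in> M" "W \<subseteq> V g" using V_max[OF W(1)] by blast
        then have "f = g" using V_inj f(1) W(2) by blast
        then show ?thesis using g W(2) by blast
      qed
      then show "Z \<in> irreducible_components T"
        using V_irr[OF f(1)] f(2) by (auto simp: irreducible_components_def)
    qed
  qed
  moreover have "vanishing_ideal r (V f) = pideal r f" if f: "f \<in> M" for f
  proof
    show "vanishing_ideal r (V f) \<subseteq> pideal r f" using point[OF f] by (auto simp: vanishing_ideal_def)
    show "pideal r f \<subseteq> vanishing_ideal r (V f)"
      using fv[OF f] by (auto simp: vanishing_ideal_def V_def zero_locus_def mem_pideal_iff carrier_coord_ring)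
  qed
  ultimately show ?thesis unfolding component_subschemes_def T_def[symmetric] by (simp add: image_image)
qed

section \<open>Membership in the conductor\<close>

text \<open>
  For a coefficient list of length \<open>d + 1\<close>, leading coefficient first, this is \<open>t\<^sup>d\<close>
  times its value at \<open>a / t\<close>.  It expresses integral equations for fractions without denominators.
\<close>

primrec homog_eval :: "'a::comm_semiring_1 list \<Rightarrow> 'a \<Rightarrow> 'a \<Rightarrow> 'a" where
  "homog_eval [] a t = 0"
| "homog_eval (c # cs) a t = c * a ^ length cs + t * homog_eval cs a t"

text \<open>
  The residue class of \<open>t\<close> is a nonzerodivisor of \<open>S / G\<close>, so that it may serve as a denominator.
\<close>

definition regular_mod :: "nat \<Rightarrow> ('k::field) poly_nat \<Rightarrow> 'k poly_nat \<Rightarrow> bool" where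
  "regular_mod r G t \<longleftrightarrow> (\<forall>b \<in> vars (Suc r). G dvd t * b \<longrightarrow> G dvd b)"

text \<open>
  The fraction \<open>a / t\<close> is integral over \<open>S / G\<close>.
\<close>

definition integral_mod :: "nat \<Rightarrow> ('k::field) poly_nat \<Rightarrow> 'k poly_nat \<Rightarrow> 'k poly_nat \<Rightarrow> bool" where
  "integral_mod r G a t \<longleftrightarrow> (\<exists>cs. set cs \<subseteq> vars (Suc r) \<and> G dvd homog_eval (1 # cs) a t)"

lemma homog_eval_in_vars:
  "set cs \<subseteq> vars n \<Longrightarrow> a \<in> vars n \<Longrightarrow> t \<in> vars n \<Longrightarrow> homog_eval cs a t \<in> vars n"
  by (induction cs) simp_all

lemma coord_ring_minus:
  assumes "a \<in> vars (Suc r)" "b \<in> vars (Suc r)"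
  shows "a \<ominus>\<^bsub>coord_ring r\<^esub> b = a - (b :: ('k::field) poly_nat)"
proof -
  interpret cring "coord_ring r :: 'k poly_nat ring" by (rule cring_coord_ring)
  have "\<ominus>\<^bsub>coord_ring r\<^esub> b = - b"
    using assms by (intro minus_equality) (simp_all add: coord_ring_def carrier_coord_ring[unfolded coord_ring_def, simplified])
  then show ?thesis by (simp add: a_minus_def) (simp add: coord_ring_def)
qed

context
  fixes r :: nat and G :: "('k::field) poly_nat"
  assumes G: "G \<in> vars (Suc r)"
begin

abbreviation "quot \<equiv> coord_ring r Quot pideal r G"
abbreviation "residue s \<equiv> pideal r G +>\<^bsub>coord_ring r\<^esub> s"
abbreviation "Frac \<equiv> total_quotient_ring quot"

lemma cring_quot: "cring quot"
  by (rule ideal.quotient_is_cring[OF ideal_pideal[OF G] cring_coord_ring])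

interpretation quot: cring quot by (rule cring_quot)

lemma residue_hom: "(\<lambda>s. residue s) \<in> ring_hom (coord_ring r) quot"
  by (rule ideal.rcos_ring_hom[OF ideal_pideal[OF G]])

lemma residue_mult:
  "a \<in> vars (Suc r) \<Longrightarrow> b \<in> vars (Suc r) \<Longrightarrow> residue a \<otimes>\<^bsub>quot\<^esub> residue b = residue (a * b)"
  using ring_hom_mult[OF residue_hom, of a b] by (simp add: carrier_coord_ring) (simp add: coord_ring_def)

lemma residue_add:
  "a \<in> vars (Suc r) \<Longrightarrow> b \<in> vars (Suc r) \<Longrightarrow> residue a \<oplus>\<^bsub>quot\<^esub> residue b = residue (a + b)"
  using ring_hom_add[OF residue_hom, of a b] by (simp add: carrier_coord_ring) (simp add: coord_ring_def)

lemma residue_one: "\<one>\<^bsub>quot\<^esub> = residue 1"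
  using ring_hom_one[OF residue_hom] by (simp add: coord_ring_def)

lemma residue_zero: "\<zero>\<^bsub>quot\<^esub> = residue 0"
  using ring_hom_zero[OF residue_hom cring.axioms(1)[OF cring_coord_ring] cring.axioms(1)[OF cring_quot]]
  by (simp add: coord_ring_def)

lemma carrier_quot: "carrier quot = (\<lambda>s. residue s) ` vars (Suc r)"
  by (auto simp: FactRing_def A_RCOSETS_def' carrier_coord_ring)

lemma residue_closed: "s \<in> vars (Suc r) \<Longrightarrow> residue s \<in> carrier quot"
  using carrier_quot by blast

lemma residue_eq_iff:
  assumes "a \<in> vars (Suc r)" "b \<in> vars (Suc r)"
  shows "residue a = residue b \<longleftrightarrow> G dvd a - b"
  using ring.quotient_eq_iff_same_a_r_cos[OF cring.axioms(1)[OF cring_coord_ring] ideal_pideal[OF G], of a b]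
    assms by (simp add: carrier_coord_ring coord_ring_minus mem_pideal_iff[OF G])

lemma residue_eq_zero_iff: "a \<in> vars (Suc r) \<Longrightarrow> residue a = \<zero>\<^bsub>quot\<^esub> \<longleftrightarrow> G dvd a"
  by (simp add: residue_zero residue_eq_iff)

lemma residue_nonzerodivisor_iff:
  assumes "t \<in> vars (Suc r)"
  shows "residue t \<in> nonzerodivisors quot \<longleftrightarrow> regular_mod r G t"
  using assms
  by (simp add: nonzerodivisors_def residue_closed carrier_quot residue_mult residue_eq_zero_iff regular_mod_def)

lemma regular_power: "regular_mod r G t \<Longrightarrow> t \<in> vars (Suc r) \<Longrightarrow> residue (t ^ k) \<in> nonzerodivisors quot"
proof (induction k)
  case 0
  then show ?case by (simp add: residue_one[symmetric])
next
  case (Suc k)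
  then show ?case using quot.nonzerodivisors_mult residue_nonzerodivisor_iff by (simp flip: residue_mult)
qed

lemma fraction_power:
  assumes "a \<in> vars (Suc r)" "t \<in> vars (Suc r)" "regular_mod r G t"
  shows "fraction quot (residue a) (residue t) [^]\<^bsub>Frac\<^esub> k = fraction quot (residue (a ^ k)) (residue (t ^ k))"
proof (induction k)
  case 0
  then show ?case by (simp add: quot.total_quotient_ring_one residue_one)
next
  case (Suc k)
  then show ?case
    using assms regular_power[of t 1] regular_power[of t k]
    by (simp add: quot.fraction_mult residue_closed residue_mult mult.commute)
qed

text \<open>
  The additional factor \<open>t\<close> in numerator and denominator makes the formula hold for the empty list,
  where the degree of the polynomial would be \<open>-1\<close>.
\<close>

lemma eval_fraction:
  assumes "set cs \<subseteq> vars (Suc r)" "a \<in> vars (Suc r)" "t \<in> vars (Suc r)" "regular_mod r G t"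
  shows "ring.eval Frac (map (\<lambda>c. to_quotients quot (residue c)) cs) (fraction quot (residue a) (residue t)) =
    fraction quot (residue (t * homog_eval cs a t)) (residue (t ^ length cs))"
  using assms(1)
proof (induction cs)
  case Nil
  interpret Frac: cring Frac by (rule quot.cring_total_quotient_ring)
  show ?case by (simp add: quot.total_quotient_ring_zero residue_zero residue_one)
next
  case (Cons c cs)
  interpret Frac: cring Frac by (rule quot.cring_total_quotient_ring)
  let ?l = "length cs" and ?h = "homog_eval cs a t"
  have v: "c \<in> vars (Suc r)" "set cs \<subseteq> vars (Suc r)" using Cons.prems by auto
  have h: "?h \<in> vars (Suc r)" using v(2) assms by (intro homog_eval_in_vars)
  have t: "residue (t ^ k) \<in> nonzerodivisors quot" for k using assms regular_power by blast
  have one: "residue 1 \<in> nonzerodivisors quot" using t[of 0] by simp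
  have "Frac.eval (map (\<lambda>c. to_quotients quot (residue c)) (c # cs)) (fraction quot (residue a) (residue t)) =
      to_quotients quot (residue c) \<otimes>\<^bsub>Frac\<^esub> (fraction quot (residue a) (residue t) [^]\<^bsub>Frac\<^esub> ?l)
      \<oplus>\<^bsub>Frac\<^esub> Frac.eval (map (\<lambda>c. to_quotients quot (residue c)) cs) (fraction quot (residue a) (residue t))"
    by simp
  also have "\<dots> = fraction quot (residue (c * a ^ ?l)) (residue (t ^ ?l)) \<oplus>\<^bsub>Frac\<^esub>
      fraction quot (residue (t * ?h)) (residue (t ^ ?l))"
    using v assms t one unfolding Cons.IH[OF v(2)] fraction_power[OF assms(2-4)]
    by (simp add: to_quotients_def residue_one quot.fraction_mult residue_closed residue_mult)
  also have "\<dots> = fraction quot (residue (c * a ^ ?l * t ^ ?l + t * ?h * t ^ ?l)) (residue (t ^ ?l * t ^ ?l))"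
    using v h assms t by (simp add: quot.fraction_add residue_closed residue_mult residue_add)
  also have "\<dots> = fraction quot (residue (t * homog_eval (c # cs) a t)) (residue (t ^ length (c # cs)))"
  proof (subst quot.fraction_eq_iff)
    show "residue (t ^ ?l * t ^ ?l) \<in> nonzerodivisors quot" using t[of "?l + ?l"] by (simp add: power_add)
    show "residue (t ^ length (c # cs)) \<in> nonzerodivisors quot" by (rule t)
    show "residue (c * a ^ ?l * t ^ ?l + t * ?h * t ^ ?l) \<otimes>\<^bsub>quot\<^esub> residue (t ^ length (c # cs)) =
        residue (t * homog_eval (c # cs) a t) \<otimes>\<^bsub>quot\<^esub> residue (t ^ ?l * t ^ ?l)"
      using v h assms by (simp add: residue_mult algebra_simps)
  qed (use v h assms in \<open>simp_all add: residue_closed\<close>)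
  finally show ?case .
qed

lemma integral_fraction_iff:
  assumes "a \<in> vars (Suc r)" "t \<in> vars (Suc r)" "regular_mod r G t"
  shows "integral_over Frac (to_quotients quot ` carrier quot) (fraction quot (residue a) (residue t)) \<longleftrightarrow>
    integral_mod r G a t"
proof -
  let ?q = "\<lambda>c. to_quotients quot (residue c)"
  have t: "residue (t ^ k) \<in> nonzerodivisors quot" for k using assms regular_power by blast
  have zero: "ring.eval Frac (map ?q cs) (fraction quot (residue a) (residue t)) = \<zero>\<^bsub>Frac\<^esub> \<longleftrightarrow>
      G dvd homog_eval cs a t" if cs: "set cs \<subseteq> vars (Suc r)" for cs
  proof -
    have h: "homog_eval cs a t \<in> vars (Suc r)" using cs assms by (intro homog_eval_in_vars)
    have "ring.eval Frac (map ?q cs) (fraction quot (residue a) (residue t)) = \<zero>\<^bsub>Frac\<^esub> \<longleftrightarrow>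
        G dvd t * homog_eval cs a t"
      unfolding eval_fraction[OF cs assms] quot.total_quotient_ring_zero using t[of 0] t[of "length cs"] h assms
      by (subst quot.fraction_eq_iff)
        (simp_all add: residue_zero residue_one residue_mult residue_closed residue_eq_iff)
    also have "\<dots> \<longleftrightarrow> G dvd homog_eval cs a t"
      using assms(3) h unfolding regular_mod_def by (blast intro: dvd_mult)
    finally show ?thesis .
  qed
  show ?thesis
  proof
    assume "integral_over Frac (to_quotients quot ` carrier quot) (fraction quot (residue a) (residue t))"
    then obtain p where p: "p \<noteq> []" "set p \<subseteq> to_quotients quot ` carrier quot" "hd p = \<one>\<^bsub>Frac\<^esub>"
      "ring.eval Frac p (fraction quot (residue a) (residue t)) = \<zero>\<^bsub>Frac\<^esub>"
      unfolding integral_over_def by blast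
    have "set (tl p) \<subseteq> ?q ` vars (Suc r)"
      using p(1,2) unfolding carrier_quot by (auto simp: image_image dest!: list.set_sel(2))
    then have "tl p \<in> map ?q ` lists (vars (Suc r))"
      unfolding lists_image[symmetric] by auto
    then obtain cs where cs: "set cs \<subseteq> vars (Suc r)" "tl p = map ?q cs" by auto
    have "p = map ?q (1 # cs)"
      using p(1,3) cs(2) by (cases p) (simp_all add: quot.total_quotient_ring_one residue_one to_quotients_def)
    then have "G dvd homog_eval (1 # cs) a t"
      using zero[of "1 # cs"] p(4) cs(1) by simp
    then show "integral_mod r G a t" unfolding integral_mod_def using cs(1) by blast
  next
    assume "integral_mod r G a t"
    then obtain cs where cs: "set cs \<subseteq> vars (Suc r)" "G dvd homog_eval (1 # cs) a t"
      unfolding integral_mod_def by blast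
    show "integral_over Frac (to_quotients quot ` carrier quot) (fraction quot (residue a) (residue t))"
      unfolding integral_over_def
    proof (intro exI conjI)
      show "map ?q (1 # cs) \<noteq> []" by simp
      show "set (map ?q (1 # cs)) \<subseteq> to_quotients quot ` carrier quot"
        using cs(1) residue_closed by auto
      show "hd (map ?q (1 # cs)) = \<one>\<^bsub>Frac\<^esub>"
        by (simp add: quot.total_quotient_ring_one residue_one to_quotients_def)
      show "ring.eval Frac (map ?q (1 # cs)) (fraction quot (residue a) (residue t)) = \<zero>\<^bsub>Frac\<^esub>"
        using zero[of "1 # cs"] cs by simp
    qed
  qed
qed

text \<open>
  Clearing denominators turns \<open>s (a / t) \<in> S / G\<close> into a congruence modulo \<open>G\<close>.
\<close>

lemma conductor_iff:
  "s \<in> conductor r (pideal r G) \<longleftrightarrow> s \<in> vars (Suc r) \<and>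
    (\<forall>a \<in> vars (Suc r). \<forall>t \<in> vars (Suc r). regular_mod r G t \<longrightarrow> integral_mod r G a t \<longrightarrow>
       (\<exists>u \<in> vars (Suc r). G dvd s * a - u * t))"
proof -
  have mult: "to_quotients quot (residue s) \<otimes>\<^bsub>Frac\<^esub> fraction quot (residue a) (residue t)
      \<in> to_quotients quot ` carrier quot \<longleftrightarrow> (\<exists>u \<in> vars (Suc r). G dvd s * a - u * t)"
    if s: "s \<in> vars (Suc r)" and a: "a \<in> vars (Suc r)" and t: "t \<in> vars (Suc r)" "regular_mod r G t"
    for a t
  proof -
    have nzd: "residue t \<in> nonzerodivisors quot" using t residue_nonzerodivisor_iff by blast
    have "to_quotients quot (residue s) \<otimes>\<^bsub>Frac\<^esub> fraction quot (residue a) (residue t) =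
        fraction quot (residue (s * a)) (residue t)"
      using s a nzd by (simp add: to_quotients_def quot.fraction_mult residue_closed residue_mult)
    moreover have "fraction quot (residue (s * a)) (residue t) = to_quotients quot (residue u) \<longleftrightarrow>
        G dvd s * a - u * t" if u: "u \<in> vars (Suc r)" for u
      unfolding to_quotients_def using s a t u nzd
      by (subst quot.fraction_eq_iff) (simp_all add: residue_closed residue_mult residue_eq_iff)
    ultimately show ?thesis unfolding carrier_quot by (auto simp: image_iff)
  qed
  have frac: "b \<in> normalization quot \<longleftrightarrow> (\<exists>a \<in> vars (Suc r). \<exists>t \<in> vars (Suc r).
      regular_mod r G t \<and> integral_mod r G a t \<and> b = fraction quot (residue a) (residue t))" for b
  proof
    assume b: "b \<in> normalization quot"
    then have "b \<in> carrier Frac" by (simp add: normalization_def)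
    then obtain x y where xy: "x \<in> carrier quot" "y \<in> nonzerodivisors quot" "b = fraction quot x y"
      by (rule quot.total_quotient_ring_cases)
    obtain a t where at: "a \<in> vars (Suc r)" "x = residue a" "t \<in> vars (Suc r)" "y = residue t"
      using xy(1) quot.nonzerodivisors_closed[OF xy(2)] unfolding carrier_quot by blast
    have "regular_mod r G t" using xy(2) at residue_nonzerodivisor_iff by blast
    moreover have "integral_mod r G a t"
      using b integral_fraction_iff[OF at(1,3) calculation] xy(3) at(2,4) by (simp add: normalization_def)
    ultimately show "\<exists>a \<in> vars (Suc r). \<exists>t \<in> vars (Suc r).
      regular_mod r G t \<and> integral_mod r G a t \<and> b = fraction quot (residue a) (residue t)"
      using at xy(3) by blast
  next
    assume "\<exists>a \<in> vars (Suc r). \<exists>t \<in> vars (Suc r).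
      regular_mod r G t \<and> integral_mod r G a t \<and> b = fraction quot (residue a) (residue t)"
    then obtain a t where at: "a \<in> vars (Suc r)" "t \<in> vars (Suc r)" "regular_mod r G t"
      "integral_mod r G a t" "b = fraction quot (residue a) (residue t)" by blast
    have "residue t \<in> nonzerodivisors quot" using at residue_nonzerodivisor_iff by blast
    then show "b \<in> normalization quot"
      using at integral_fraction_iff[OF at(1-3)] by (simp add: normalization_def residue_closed)
  qed
  have all: "(\<forall>b \<in> normalization quot. P b) \<longleftrightarrow> (\<forall>a \<in> vars (Suc r). \<forall>t \<in> vars (Suc r).
      regular_mod r G t \<longrightarrow> integral_mod r G a t \<longrightarrow> P (fraction quot (residue a) (residue t)))" for P
    unfolding Ball_def frac by blast
  have "s \<in> conductor r (pideal r G) \<longleftrightarrow> s \<in> vars (Suc r) \<and> (\<forall>b \<in> normalization quot.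
      to_quotients quot (residue s) \<otimes>\<^bsub>Frac\<^esub> b \<in> to_quotients quot ` carrier quot)"
    by (simp add: conductor_def Let_def carrier_coord_ring)
  also have "\<dots> \<longleftrightarrow> s \<in> vars (Suc r) \<and>
    (\<forall>a \<in> vars (Suc r). \<forall>t \<in> vars (Suc r). regular_mod r G t \<longrightarrow> integral_mod r G a t \<longrightarrow>
       (\<exists>u \<in> vars (Suc r). G dvd s * a - u * t))"
    unfolding all by (intro conj_cong ball_cong imp_cong mult refl)
  finally show ?thesis .
qed

end

lemma homog_eval_scale:
  "g * homog_eval cs (g * a) (g * t) = g ^ length cs * homog_eval cs a t"
proof (induction cs)
  case (Cons c cs)
  have "g * homog_eval (c # cs) (g * a) (g * t) =
      g * (c * (g * a) ^ length cs) + g * t * (g * homog_eval cs (g * a) (g * t))"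
    by (simp add: distrib_left mult_ac)
  also have "\<dots> = g ^ length (c # cs) * homog_eval (c # cs) a t"
    unfolding Cons.IH by (simp add: power_mult_distrib distrib_left mult_ac)
  finally show ?case .
qed simp

lemma homog_eval_cong:
  fixes p :: "'a::comm_ring_1"
  assumes "p dvd t - t'"
  shows "p dvd homog_eval cs a t - homog_eval cs a t'"
proof (induction cs)
  case (Cons c cs)
  have "homog_eval (c # cs) a t - homog_eval (c # cs) a t' =
      (t - t') * homog_eval cs a t + t' * (homog_eval cs a t - homog_eval cs a t')"
    by (simp add: algebra_simps)
  then show ?case using assms Cons by simp
qed simp

text \<open>
  Appending a zero coefficient multiplies the polynomial by its variable.
\<close>

lemma homog_eval_snoc_0: "homog_eval (cs @ [0]) a t = a * homog_eval cs a t"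
  by (induction cs) (simp_all add: algebra_simps)

section \<open>Decomposing the conductor of a product of primes\<close>

text \<open>
  The nonzerodivisors modulo a product of distinct primes are the elements that vanish identically
  on none of the components.
\<close>

lemma regular_mod_prod_iff:
  fixes t :: "('k::field) poly_nat"
  assumes M: "nonassociate_primes M" "M \<subseteq> vars (Suc r)"
  shows "regular_mod r (\<Prod>M) t \<longleftrightarrow> (\<forall>f \<in> M. \<not> f dvd t)"
proof
  have fin: "finite M" using M(1) by (simp add: nonassociate_primes_def)
  assume reg: "regular_mod r (\<Prod>M) t"
  show "\<forall>f \<in> M. \<not> f dvd t"
  proof (intro ballI notI)
    fix f assume f: "f \<in> M" "f dvd t"
    have P: "\<Prod>M = f * \<Prod>(M - {f})" using fin f(1) by (rule prod.remove)
    have "\<Prod>(M - {f}) \<in> vars (Suc r)" using M(2) by (intro vars_prod) auto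
    moreover have "\<Prod>M dvd t * \<Prod>(M - {f})" unfolding P using f(2) by (intro mult_dvd_mono) simp_all
    ultimately have "\<Prod>M dvd \<Prod>(M - {f})" using reg unfolding regular_mod_def by blast
    then have "f dvd \<Prod>(M - {f})" unfolding P by (rule dvd_mult_left)
    then show False using prime_dvd_prod_iff[OF M(1), of "M - {f}" f] f(1) by blast
  qed
next
  assume *: "\<forall>f \<in> M. \<not> f dvd t"
  have fin: "finite M" and prime: "\<And>f. f \<in> M \<Longrightarrow> prime_elem f"
    using M(1) by (auto simp: nonassociate_primes_def)
  show "regular_mod r (\<Prod>M) t"
    unfolding regular_mod_def
  proof (intro ballI impI)
    fix b assume b: "\<Prod>M dvd t * b"
    show "\<Prod>M dvd b"
    proof (rule prod_primes_dvd[OF M(1)])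
      fix f assume f: "f \<in> M"
      then have "f dvd t * b" using fin b by (meson dvd_prod_eqI dvd_trans)
      then show "f dvd b" using prime_elem_dvd_multD[OF prime[OF f]] * f by blast
    qed
  qed
qed

lemma regular_mod_prime_iff:
  assumes "prime_elem f" "f \<in> vars (Suc r)"
  shows "regular_mod r f t \<longleftrightarrow> \<not> f dvd t"
  using regular_mod_prod_iff[of "{f}" r t] assms by (simp add: nonassociate_primes_def)

lemma quotient_in_vars:
  assumes "u \<in> vars n" "G dvd u"
  obtains v where "v \<in> vars n" "u = G * v"
proof (cases "u = 0")
  case True
  then show ?thesis using that[of 0] by simp
next
  case False
  obtain v where "u = G * v" using assms(2) by (metis dvdE)
  then show ?thesis using that[of v] vars_factor[OF assms(1) False, of v] by auto
qed

text \<open>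
  The fraction \<open>a / t\<close> on the component \<open>f = 0\<close> is extended by zero to the other components, where
  \<open>\<Prod>(M - {f})\<close> vanishes.  If \<open>p\<close> is an integral equation of \<open>a / t\<close>, then the polynomial \<open>X p(X)\<close> is one for
  the extension: modulo \<open>f\<close> because of \<open>p\<close>, and modulo the other primes because of the factor \<open>X\<close>.
\<close>

lemma conductor_clears_fraction_on_component:
  fixes s :: "('k::field) poly_nat"
  assumes M: "nonassociate_primes M" "M \<subseteq> vars (Suc r)" and f: "f \<in> M"
    and s: "s \<in> conductor r (pideal r (\<Prod>M))"
    and a: "a \<in> vars (Suc r)" and t: "t \<in> vars (Suc r)" "\<not> f dvd t"
    and int: "integral_mod r f a t"
  shows "\<exists>v \<in> vars (Suc r). f dvd s * a - \<Prod>(M - {f}) * v * t"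
proof -
  have fin: "finite M" and prime: "\<And>f. f \<in> M \<Longrightarrow> prime_elem f"
    using M(1) by (auto simp: nonassociate_primes_def)
  define G where "G = \<Prod>(M - {f})"
  have fv: "f \<in> vars (Suc r)" using M(2) f by auto
  have Gv: "G \<in> vars (Suc r)" unfolding G_def using M(2) by (intro vars_prod) auto
  have Pv: "\<Prod>M \<in> vars (Suc r)" using M(2) by (intro vars_prod) auto
  have P: "\<Prod>M = f * G" unfolding G_def using fin f by (rule prod.remove)
  have fG: "\<not> f dvd G" unfolding G_def using prime_dvd_prod_iff[OF M(1), of "M - {f}" f] f by blast
  have gG: "g dvd G" if "g \<in> M - {f}" for g
    unfolding G_def using fin that by (intro dvd_prod_eqI[of _ g]) auto
  \<comment> \<open>The fraction \<open>a' / t'\<close> equals \<open>a / t\<close> modulo \<open>f\<close> and \<open>0\<close> modulo every other prime.  The summand \<open>f\<close>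
    in \<open>t'\<close> keeps the denominator nonzero modulo the other primes.\<close>
  define a' where "a' = G * a"
  define t' where "t' = G * t + f"
  have v': "a' \<in> vars (Suc r)" "t' \<in> vars (Suc r)" using Gv a t(1) fv by (simp_all add: a'_def t'_def)
  have not_dvd: "\<not> g dvd t'" if g: "g \<in> M" for g
  proof (cases "g = f")
    case True
    have "\<not> f dvd G * t" using prime_elem_dvd_multD[OF prime[OF f]] fG t(2) by blast
    then show ?thesis unfolding True t'_def by (simp add: dvd_add_left_iff)
  next
    case False
    then have "g dvd G * t" using gG g by simp
    moreover have "\<not> g dvd f" using M(1) f g False by (auto simp: nonassociate_primes_def)
    ultimately show ?thesis unfolding t'_def by (simp add: dvd_add_right_iff)
  qed
  then have reg: "regular_mod r (\<Prod>M) t'" using regular_mod_prod_iff[OF M] by blast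
  obtain cs where cs: "set cs \<subseteq> vars (Suc r)" "f dvd homog_eval (1 # cs) a t"
    using int unfolding integral_mod_def by blast
  have "\<Prod>M dvd homog_eval (1 # (cs @ [0])) a' t'"
  proof (rule prod_primes_dvd[OF M(1)])
    fix g assume g: "g \<in> M"
    have eq: "homog_eval (1 # (cs @ [0])) a' t' = a' * homog_eval (1 # cs) a' t'"
      using homog_eval_snoc_0[of "1 # cs"] by simp
    show "g dvd homog_eval (1 # (cs @ [0])) a' t'"
    proof (cases "g = f")
      case True
      have "f dvd G * homog_eval (1 # cs) (G * a) (G * t)"
        unfolding homog_eval_scale using cs(2) by (rule dvd_mult)
      then have "f dvd homog_eval (1 # cs) a' (G * t)"
        using prime_elem_dvd_multD[OF prime[OF f]] fG unfolding a'_def by blast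
      moreover have "f dvd homog_eval (1 # cs) a' t' - homog_eval (1 # cs) a' (G * t)"
        by (rule homog_eval_cong) (simp add: t'_def)
      ultimately have "f dvd (homog_eval (1 # cs) a' t' - homog_eval (1 # cs) a' (G * t)) +
          homog_eval (1 # cs) a' (G * t)"
        by (intro dvd_add)
      then have "f dvd homog_eval (1 # cs) a' t'" by (simp only: diff_add_cancel)
      then show ?thesis unfolding eq True by (rule dvd_mult)
    next
      case False
      then have "g dvd a'" unfolding a'_def using gG g by simp
      then show ?thesis unfolding eq by (rule dvd_mult2)
    qed
  qed
  \<comment> \<open>Hence \<open>s\<close> times this fraction is the class of a polynomial \<open>u\<close>.\<close>
  then have "integral_mod r (\<Prod>M) a' t'"
    unfolding integral_mod_def using cs(1) by (intro exI[of _ "cs @ [0]"]) simp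
  then obtain u where u: "u \<in> vars (Suc r)" "\<Prod>M dvd s * a' - u * t'"
    using s v' reg conductor_iff[OF Pv] by blast
  have "G dvd u"
    unfolding G_def
  proof (rule prod_primes_dvd)
    show "nonassociate_primes (M - {f})" using M(1) by (rule nonassociate_primes_subset) auto
    fix g assume g: "g \<in> M - {f}"
    have "g dvd \<Prod>M" unfolding P using gG[OF g] by simp
    then have "g dvd s * a' - u * t'" using u(2) dvd_trans by blast
    moreover have "g dvd s * a'" unfolding a'_def using gG[OF g] by simp
    ultimately have "g dvd s * a' - (s * a' - u * t')" by (rule dvd_diff[rotated])
    then have "g dvd u * t'" by simp
    then show "g dvd u" using prime_elem_dvd_multD[OF prime] not_dvd g by blast
  qed
  then obtain v where v: "v \<in> vars (Suc r)" "u = G * v" using quotient_in_vars u(1) by blast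
  have "f dvd s * a' - u * t'" using u(2) unfolding P by (rule dvd_mult_left)
  also have "s * a' - u * t' = G * (s * a - v * t')" by (simp add: v(2) a'_def algebra_simps)
  finally have "f dvd s * a - v * t'" using prime_elem_dvd_multD[OF prime[OF f]] fG by blast
  then have "f dvd (s * a - v * t') + f * v" by simp
  also have "(s * a - v * t') + f * v = s * a - G * v * t" by (simp add: t'_def algebra_simps)
  finally show ?thesis using v(1) unfolding G_def by blast
qed

text \<open>
  The element \<open>h\<close> comes from the fraction \<open>1 / 1\<close>, whose extension by zero is the idempotent of the
  component.  It clears every other integral fraction because \<open>G h a \<equiv> s a \<equiv> G v t\<close> modulo \<open>f\<close> for
  \<open>G = \<Prod>(M - {f})\<close>, which can be cancelled.
\<close>

lemma conductor_decomposes_on_component: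
  fixes s :: "('k::field) poly_nat"
  assumes M: "nonassociate_primes M" "M \<subseteq> vars (Suc r)" and f: "f \<in> M"
    and s: "s \<in> conductor r (pideal r (\<Prod>M))"
  shows "\<exists>h \<in> conductor r (pideal r f). f dvd s - \<Prod>(M - {f}) * h"
proof -
  have prime: "prime_elem f" using M(1) f by (auto simp: nonassociate_primes_def)
  have fv: "f \<in> vars (Suc r)" using M(2) f by auto
  have fG: "\<not> f dvd \<Prod>(M - {f})" using prime_dvd_prod_iff[OF M(1), of "M - {f}" f] f by blast
  \<comment> \<open>The fraction \<open>1 / 1\<close> is a root of \<open>X - 1\<close>.\<close>
  have "integral_mod r f 1 1"
    unfolding integral_mod_def by (intro exI[of _ "[-1]"]) simp
  then obtain h where h: "h \<in> vars (Suc r)" "f dvd s - \<Prod>(M - {f}) * h"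
    using conductor_clears_fraction_on_component[OF M f s, of 1 1] prime_elem_not_unit[OF prime] by auto
  have "h \<in> conductor r (pideal r f)"
    unfolding conductor_iff[OF fv] regular_mod_prime_iff[OF prime fv]
  proof (intro conjI ballI impI h(1))
    fix a t :: "'k poly_nat"
    assume "a \<in> vars (Suc r)" "t \<in> vars (Suc r)" "\<not> f dvd t" "integral_mod r f a t"
    then obtain v where v: "v \<in> vars (Suc r)" "f dvd s * a - \<Prod>(M - {f}) * v * t"
      using conductor_clears_fraction_on_component[OF M f s] by blast
    have "f dvd (s * a - \<Prod>(M - {f}) * v * t) - (s - \<Prod>(M - {f}) * h) * a"
      by (intro dvd_diff v(2) dvd_mult2 h(2))
    also have "\<dots> = \<Prod>(M - {f}) * (h * a - v * t)" by (simp add: algebra_simps)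
    finally have "f dvd h * a - v * t" using prime_elem_dvd_multD[OF prime] fG by blast
    then show "\<exists>u \<in> vars (Suc r). f dvd h * a - u * t" using v(1) by blast
  qed
  then show ?thesis using h(2) by blast
qed

text \<open>
  Modulo \<open>f\<close> only the summand of \<open>f\<close> survives, so the local decompositions add up to \<open>s\<close> modulo
  \<open>\<Prod>M\<close>.
\<close>

lemma conductor_subset_sum:
  fixes s :: "('k::field) poly_nat"
  assumes M: "nonassociate_primes M" "M \<subseteq> vars (Suc r)" "M \<noteq> {}"
    and s: "s \<in> conductor r (pideal r (\<Prod>M))"
  shows "\<exists>h. (\<forall>f \<in> M. h f \<in> conductor r (pideal r f)) \<and> s = (\<Sum>f \<in> M. h f * \<Prod>(M - {f}))"
proof -
  have fin: "finite M" using M(1) by (auto simp: nonassociate_primes_def)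
  obtain h where h: "\<And>f. f \<in> M \<Longrightarrow> h f \<in> conductor r (pideal r f)"
    "\<And>f. f \<in> M \<Longrightarrow> f dvd s - \<Prod>(M - {f}) * h f"
    using conductor_decomposes_on_component[OF M(1,2) _ s] by metis
  have Pv: "\<Prod>M \<in> vars (Suc r)" using M(2) by (intro vars_prod) auto
  have hv: "h f \<in> vars (Suc r)" if "f \<in> M" for f
    using h(1)[OF that] that M(2) conductor_iff by blast
  let ?d = "s - (\<Sum>f \<in> M. h f * \<Prod>(M - {f}))"
  have "\<Prod>M dvd ?d"
  proof (rule prod_primes_dvd[OF M(1)])
    fix f assume f: "f \<in> M"
    have "f dvd h g * \<Prod>(M - {g})" if "g \<in> M - {f}" for g
      using f that fin by (intro dvd_mult dvd_prod_eqI[of _ f]) auto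
    then have "f dvd (\<Sum>g \<in> M - {f}. h g * \<Prod>(M - {g}))" by (rule dvd_sum)
    then have "f dvd (s - \<Prod>(M - {f}) * h f) - (\<Sum>g \<in> M - {f}. h g * \<Prod>(M - {g}))"
      using h(2)[OF f] by (rule dvd_diff[rotated])
    also have "\<dots> = ?d" by (simp add: sum.remove[OF fin f] mult.commute)
    finally show "f dvd ?d" .
  qed
  moreover have "?d \<in> vars (Suc r)"
  proof (intro vars_diff vars_sum vars_mult)
    show "s \<in> vars (Suc r)" using s conductor_iff[OF Pv] by blast
    show "\<Prod>(M - {f}) \<in> vars (Suc r)" for f using M(2) by (intro vars_prod) auto
  qed (rule hv)
  ultimately obtain k where k: "k \<in> vars (Suc r)" "?d = \<Prod>M * k" using quotient_in_vars by blast
  obtain f where f: "f \<in> M" using M(3) by blast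
  have fv: "f \<in> vars (Suc r)" using f M(2) by blast
  \<comment> \<open>The error \<open>k \<Prod>M = (f k) \<Prod>(M - {f})\<close> goes into the summand of one chosen \<open>f\<close>, since multiples of
    \<open>f\<close> lie in the conductor of \<open>f\<close>.\<close>
  let ?h = "h(f := h f + f * k)"
  have "?h g \<in> conductor r (pideal r g)" if "g \<in> M" for g
  proof (cases "g = f")
    case True
    have "\<exists>u \<in> vars (Suc r). f dvd (h f + f * k) * a - u * t"
      if at: "a \<in> vars (Suc r)" "t \<in> vars (Suc r)" "regular_mod r f t" "integral_mod r f a t" for a t
    proof -
      obtain u where "u \<in> vars (Suc r)" "f dvd h f * a - u * t"
        using h(1)[OF f] at conductor_iff[OF fv] by blast
      moreover have "(h f + f * k) * a - u * t = (h f * a - u * t) + f * (k * a)"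
        by (simp add: algebra_simps)
      ultimately show ?thesis by (metis dvd_add dvd_triv_left)
    qed
    then show ?thesis
      unfolding True conductor_iff[OF fv] using hv[OF f] fv k(1) by simp
  qed (use h(1) that in simp)
  moreover have "s = (\<Sum>g \<in> M. ?h g * \<Prod>(M - {g}))"
  proof -
    have "(\<Sum>g \<in> M. ?h g * \<Prod>(M - {g})) =
        (\<Sum>g \<in> M. h g * \<Prod>(M - {g})) + f * k * \<Prod>(M - {f})"
      by (simp add: sum.remove[OF fin f] distrib_right)
    also have "f * k * \<Prod>(M - {f}) = \<Prod>M * k" by (simp add: prod.remove[OF fin f] mult_ac)
    also have "(\<Sum>g \<in> M. h g * \<Prod>(M - {g})) + \<Prod>M * k = s" unfolding k(2)[symmetric] by simp
    finally show ?thesis by (rule sym)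
  qed
  ultimately show ?thesis by blast
qed

text \<open>
  A fraction that is integral modulo \<open>\<Prod>M\<close> is integral modulo \<open>f\<close>, and multiplying by the other primes
  lifts the resulting congruence from \<open>f\<close> back to \<open>\<Prod>M\<close>.
\<close>

lemma component_conductor_times_complement:
  fixes h :: "('k::field) poly_nat"
  assumes M: "nonassociate_primes M" "M \<subseteq> vars (Suc r)" and f: "f \<in> M"
    and h: "h \<in> conductor r (pideal r f)" and g: "g \<in> vars (Suc r)" "\<Prod>(M - {f}) dvd g"
  shows "h * g \<in> conductor r (pideal r (\<Prod>M))"
proof -
  have fin: "finite M" and prime: "prime_elem f" using M(1) f by (auto simp: nonassociate_primes_def)
  have fv: "f \<in> vars (Suc r)" using M(2) f by auto
  have Pv: "\<Prod>M \<in> vars (Suc r)" using M(2) by (intro vars_prod) auto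
  have P: "\<Prod>M = f * \<Prod>(M - {f})" using fin f by (rule prod.remove)
  have hv: "h \<in> vars (Suc r)" using h conductor_iff[OF fv] by blast
  show ?thesis
    unfolding conductor_iff[OF Pv]
  proof (intro conjI ballI impI)
    show "h * g \<in> vars (Suc r)" using hv g(1) by simp
    fix a t :: "'k poly_nat"
    assume at: "a \<in> vars (Suc r)" "t \<in> vars (Suc r)" "regular_mod r (\<Prod>M) t" "integral_mod r (\<Prod>M) a t"
    have "regular_mod r f t"
      using at(3) f unfolding regular_mod_prod_iff[OF M] regular_mod_prime_iff[OF prime fv] by blast
    moreover have "integral_mod r f a t"
      using at(4) unfolding integral_mod_def P by (meson dvd_mult_left)
    ultimately obtain u where u: "u \<in> vars (Suc r)" "f dvd h * a - u * t"
      using h at(1,2) conductor_iff[OF fv] by blast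
    have "\<Prod>M dvd (h * a - u * t) * g" unfolding P using u(2) g(2) by (rule mult_dvd_mono)
    also have "(h * a - u * t) * g = h * g * a - u * g * t" by (simp add: algebra_simps)
    finally show "\<exists>u \<in> vars (Suc r). \<Prod>M dvd h * g * a - u * t"
      using u(1) g(1) by (intro bexI[of _ "u * g"]) simp_all
  qed
qed

section \<open>Sums and products of ideals\<close>

lemma coord_ring_idealI:
  fixes I :: "('k::field) poly_nat set"
  assumes "I \<subseteq> vars (Suc r)" "0 \<in> I" "\<And>a b. a \<in> I \<Longrightarrow> b \<in> I \<Longrightarrow> a + b \<in> I"
    and mult: "\<And>a x. a \<in> I \<Longrightarrow> x \<in> vars (Suc r) \<Longrightarrow> x * a \<in> I"
  shows "ideal I (coord_ring r)"
proof (rule idealI)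
  interpret cring "coord_ring r :: 'k poly_nat ring" by (rule cring_coord_ring)
  show "ring (coord_ring r :: 'k poly_nat ring)" by (rule ring_axioms)
  show "subgroup I (add_monoid (coord_ring r))"
  proof (rule add.subgroupI)
    show "I \<subseteq> carrier (coord_ring r)" using assms(1) by (simp add: carrier_coord_ring)
    show "I \<noteq> {}" using assms(2) by blast
    fix a assume a: "a \<in> I"
    then have v: "a \<in> vars (Suc r)" using assms(1) by blast
    have "\<ominus>\<^bsub>coord_ring r\<^esub> a = 0 - a"
      using coord_ring_minus[of 0 r a] v minus_zero l_zero[of "\<ominus>\<^bsub>coord_ring r\<^esub> a"]
      by (simp add: a_minus_def carrier_coord_ring) (simp add: coord_ring_def)
    then show "\<ominus>\<^bsub>coord_ring r\<^esub> a \<in> I" using mult[OF a, of "-1"] by simp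
    fix b assume "b \<in> I"
    then show "a \<oplus>\<^bsub>coord_ring r\<^esub> b \<in> I" using assms(3) a by (simp add: coord_ring_def)
  qed
  fix a x :: "'k poly_nat" assume "a \<in> I" "x \<in> carrier (coord_ring r)"
  then have "x * a \<in> I" using mult by (simp add: carrier_coord_ring)
  then show "x \<otimes>\<^bsub>coord_ring r\<^esub> a \<in> I" "a \<otimes>\<^bsub>coord_ring r\<^esub> x \<in> I"
    by (simp_all add: coord_ring_def mult.commute)
qed

lemma ideal_conductor:
  fixes G :: "('k::field) poly_nat"
  assumes G: "G \<in> vars (Suc r)"
  shows "ideal (conductor r (pideal r G)) (coord_ring r)"
proof (rule coord_ring_idealI)
  show "conductor r (pideal r G) \<subseteq> vars (Suc r)" using conductor_iff[OF G] by blast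
  show "0 \<in> conductor r (pideal r G)"
    unfolding conductor_iff[OF G] by (auto intro!: bexI[of _ 0])
  fix a b :: "'k poly_nat" assume ab: "a \<in> conductor r (pideal r G)" "b \<in> conductor r (pideal r G)"
  show "a + b \<in> conductor r (pideal r G)"
    unfolding conductor_iff[OF G]
  proof (intro conjI ballI impI)
    show "a + b \<in> vars (Suc r)" using ab conductor_iff[OF G] by simp
    fix c t :: "'k poly_nat"
    assume "c \<in> vars (Suc r)" "t \<in> vars (Suc r)" "regular_mod r G t" "integral_mod r G c t"
    then obtain u v where uv: "u \<in> vars (Suc r)" "v \<in> vars (Suc r)" "G dvd a * c - u * t" "G dvd b * c - v * t"
      using ab unfolding conductor_iff[OF G] by blast
    have "(a + b) * c - (u + v) * t = (a * c - u * t) + (b * c - v * t)" by (simp add: algebra_simps)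
    then show "\<exists>u \<in> vars (Suc r). G dvd (a + b) * c - u * t" using uv by (metis dvd_add vars_add)
  qed
next
  fix a x :: "'k poly_nat" assume a: "a \<in> conductor r (pideal r G)" and x: "x \<in> vars (Suc r)"
  show "x * a \<in> conductor r (pideal r G)"
    unfolding conductor_iff[OF G]
  proof (intro conjI ballI impI)
    show "x * a \<in> vars (Suc r)" using a x conductor_iff[OF G] by simp
    fix c t :: "'k poly_nat"
    assume "c \<in> vars (Suc r)" "t \<in> vars (Suc r)" "regular_mod r G t" "integral_mod r G c t"
    then obtain u where u: "u \<in> vars (Suc r)" "G dvd a * c - u * t"
      using a unfolding conductor_iff[OF G] by blast
    have "x * a * c - x * u * t = x * (a * c - u * t)" by (simp add: algebra_simps)
    then show "\<exists>u \<in> vars (Suc r). G dvd x * a * c - u * t" using u x by (metis dvd_mult vars_mult)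
  qed
qed

lemma ideal_prod_pideal:
  fixes f g :: "('k::field) poly_nat"
  assumes "f \<in> vars (Suc r)" "g \<in> vars (Suc r)"
  shows "pideal r f \<cdot>\<^bsub>coord_ring r\<^esub> pideal r g = pideal r (f * g)"
proof
  show "pideal r f \<cdot>\<^bsub>coord_ring r\<^esub> pideal r g \<subseteq> pideal r (f * g)"
  proof
    fix x assume "x \<in> pideal r f \<cdot>\<^bsub>coord_ring r\<^esub> pideal r g"
    then show "x \<in> pideal r (f * g)"
    proof (induction x rule: ideal_prod.induct)
      case (prod i j)
      then show ?case using assms by (simp add: mem_pideal_iff) (simp add: coord_ring_def mult_dvd_mono)
    next
      case (sum i j)
      then show ?case using assms by (simp add: mem_pideal_iff) (simp add: coord_ring_def)
    qed
  qed
  show "pideal r (f * g) \<subseteq> pideal r f \<cdot>\<^bsub>coord_ring r\<^esub> pideal r g"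
  proof
    fix x assume "x \<in> pideal r (f * g)"
    then have x: "x \<in> vars (Suc r)" "f * g dvd x" using assms by (simp_all add: mem_pideal_iff)
    then obtain y where y: "y \<in> vars (Suc r)" "x = f * g * y" using quotient_in_vars by blast
    have "f \<otimes>\<^bsub>coord_ring r\<^esub> (g * y) \<in> pideal r f \<cdot>\<^bsub>coord_ring r\<^esub> pideal r g"
      using assms y(1) by (intro ideal_prod.prod) (simp_all add: mem_pideal_iff)
    then show "x \<in> pideal r f \<cdot>\<^bsub>coord_ring r\<^esub> pideal r g" by (simp add: y(2) coord_ring_def mult.assoc)
  qed
qed

lemma pideal_inj:
  assumes M: "nonassociate_primes M" "M \<subseteq> vars (Suc r)"
  shows "inj_on (pideal r) M"
proof (rule inj_onI)
  fix f g assume fg: "f \<in> M" "g \<in> M" "pideal r f = pideal r g"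
  then have "g \<in> pideal r f" using M(2) by (auto simp: mem_pideal_iff)
  then have "f dvd g" using fg(1) M(2) by (auto simp: mem_pideal_iff)
  then show "f = g" using M(1) fg by (auto simp: nonassociate_primes_def)
qed

text \<open>
  The product is indexed by the ideals and not by their generators, which makes no difference since
  non-associate primes generate different ideals.
\<close>

lemma finprod_pideal:
  fixes M :: "('k::field) poly_nat set"
  assumes M: "nonassociate_primes M" "M \<subseteq> vars (Suc r)"
  shows "(\<Otimes>\<^bsub>ideals_set (coord_ring r)\<^esub> I \<in> pideal r ` M. I) = pideal r (\<Prod>M)"
proof -
  interpret cring "coord_ring r :: 'k poly_nat ring" by (rule cring_coord_ring)
  interpret ideals: comm_monoid "ideals_set (coord_ring r :: 'k poly_nat ring)"
    by (rule ideals_set_is_comm_monoid)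
  have "(\<Otimes>\<^bsub>ideals_set (coord_ring r)\<^esub> I \<in> pideal r ` N. I) = pideal r (\<Prod>N)"
    if "finite N" "N \<subseteq> M" for N
    using that
  proof (induction N)
    case empty
    have "carrier (coord_ring r) = pideal r 1"
      by (auto simp: mem_pideal_iff carrier_coord_ring)
    moreover have "\<one>\<^bsub>ideals_set (coord_ring r :: 'k poly_nat ring)\<^esub> = carrier (coord_ring r)"
      by (simp add: ideals_set_def)
    ultimately show ?case by simp
  next
    case (insert f N)
    have fN: "f \<in> M" "N \<subseteq> M" using insert.prems by auto
    have "pideal r f \<notin> pideal r ` N"
      using inj_on_image_mem_iff[OF pideal_inj[OF M] fN] insert.hyps(2) by blast
    moreover have ideals: "pideal r h \<in> carrier (ideals_set (coord_ring r))" if "h \<in> M" for h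
      using that M(2) by (auto simp: ideals_set_def intro: ideal_pideal)
    ultimately have "(\<Otimes>\<^bsub>ideals_set (coord_ring r)\<^esub> I \<in> pideal r ` insert f N. I) =
        pideal r f \<otimes>\<^bsub>ideals_set (coord_ring r)\<^esub> pideal r (\<Prod>N)"
      using insert fN by (simp add: image_subset_iff Pi_iff subset_iff)
    also have "\<dots> = pideal r f \<cdot>\<^bsub>coord_ring r\<^esub> pideal r (\<Prod>N)" by (simp add: ideals_set_def)
    also have "\<dots> = pideal r (f * \<Prod>N)"
      using fN M(2) by (intro ideal_prod_pideal vars_prod) auto
    finally show ?case using insert.hyps by simp
  qed
  then show ?thesis using M(1) by (simp add: nonassociate_primes_def)
qed

lemma finsum_ideals:
  fixes J :: "'i \<Rightarrow> ('k::field) poly_nat set"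
  assumes "finite N" "\<And>i. i \<in> N \<Longrightarrow> ideal (J i) (coord_ring r)"
  shows "(\<Oplus>\<^bsub>ideals_set (coord_ring r)\<^esub> i \<in> N. J i) =
    {s. \<exists>j. (\<forall>i \<in> N. j i \<in> J i) \<and> s = (\<Sum>i \<in> N. j i)}"
  using assms
proof (induction N)
  case empty
  interpret cring "coord_ring r :: 'k poly_nat ring" by (rule cring_coord_ring)
  interpret ideals: semiring "ideals_set (coord_ring r :: 'k poly_nat ring)"
    by (rule ideals_set_is_semiring)
  have "\<zero>\<^bsub>ideals_set (coord_ring r :: 'k poly_nat ring)\<^esub> = {0}"
    by (simp add: ideals_set_def coord_ring_def)
  then show ?case by simp
next
  case (insert i N)
  interpret cring "coord_ring r :: 'k poly_nat ring" by (rule cring_coord_ring)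
  interpret ideals: semiring "ideals_set (coord_ring r :: 'k poly_nat ring)"
    by (rule ideals_set_is_semiring)
  have "J k \<in> carrier (ideals_set (coord_ring r))" if "k \<in> insert i N" for k
    using insert.prems[OF that] by (simp add: ideals_set_def)
  then have "(\<Oplus>\<^bsub>ideals_set (coord_ring r)\<^esub> i \<in> insert i N. J i) =
      J i \<oplus>\<^bsub>ideals_set (coord_ring r)\<^esub> (\<Oplus>\<^bsub>ideals_set (coord_ring r)\<^esub> i \<in> N. J i)"
    using insert.hyps by (intro ideals.finsum_insert) auto
  also have "\<dots> = {a + b |a b. a \<in> J i \<and> b \<in> {s. \<exists>j. (\<forall>i \<in> N. j i \<in> J i) \<and> s = (\<Sum>i \<in> N. j i)}}"
    using insert by (auto simp: ideals_set_def set_add_def' coord_ring_def)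
  also have "\<dots> = {s. \<exists>j. (\<forall>k \<in> insert i N. j k \<in> J k) \<and> s = (\<Sum>k \<in> insert i N. j k)}"
  proof (intro equalityI subsetI; clarsimp)
    fix a j assume "a \<in> J i" "\<forall>i \<in> N. j i \<in> J i"
    then show "\<exists>j'. j' i \<in> J i \<and> (\<forall>i \<in> N. j' i \<in> J i) \<and> a + sum j N = (\<Sum>k \<in> insert i N. j' k)"
      using insert.hyps
      by (intro exI[of _ "j(i := a)"]) (auto intro!: sum.cong)
  next
    fix j assume "j i \<in> J i" "\<forall>i \<in> N. j i \<in> J i"
    then show "\<exists>a b. (\<Sum>k \<in> insert i N. j k) = a + b \<and> a \<in> J i \<and> (\<exists>j. (\<forall>i \<in> N. j i \<in> J i) \<and> b = sum j N)"
      using insert.hyps by (auto)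
  qed
  finally show ?case .
qed

lemma conductor_prod_primes:
  fixes M :: "('k::field) poly_nat set"
  assumes M: "nonassociate_primes M" "M \<subseteq> vars (Suc r)" "M \<noteq> {}"
  shows "conductor r (pideal r (\<Prod>M)) =
    (\<Oplus>\<^bsub>ideals_set (coord_ring r)\<^esub> IY \<in> pideal r ` M. conductor r IY \<cdot>\<^bsub>coord_ring r\<^esub>
       (\<Otimes>\<^bsub>ideals_set (coord_ring r)\<^esub> IZ \<in> pideal r ` M - {IY}. IZ))"
proof -
  interpret cring "coord_ring r :: 'k poly_nat ring" by (rule cring_coord_ring)
  have fin: "finite M" using M(1) by (auto simp: nonassociate_primes_def)
  define J where "J IY = conductor r IY \<cdot>\<^bsub>coord_ring r\<^esub>
       (\<Otimes>\<^bsub>ideals_set (coord_ring r)\<^esub> IZ \<in> pideal r ` M - {IY}. IZ)" for IY :: "'k poly_nat set"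
  have Pv: "\<Prod>M \<in> vars (Suc r)" using M(2) by (intro vars_prod) auto
  have Gv: "\<Prod>(M - {f}) \<in> vars (Suc r)" for f using M(2) by (intro vars_prod) auto
  have J: "J (pideal r f) = conductor r (pideal r f) \<cdot>\<^bsub>coord_ring r\<^esub> pideal r (\<Prod>(M - {f}))"
    if f: "f \<in> M" for f
  proof -
    have "pideal r ` M - {pideal r f} = pideal r ` (M - {f})"
      using inj_on_image_set_diff[OF pideal_inj[OF M(1,2)], of M "{f}"] f by simp
    moreover have "(\<Otimes>\<^bsub>ideals_set (coord_ring r)\<^esub> I \<in> pideal r ` (M - {f}). I) = pideal r (\<Prod>(M - {f}))"
      using M(2) nonassociate_primes_subset[OF M(1)] by (intro finprod_pideal) auto
    ultimately show ?thesis by (simp only: J_def)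
  qed
  have J_ideal: "ideal (J I) (coord_ring r)" if "I \<in> pideal r ` M" for I
    using that J M(2) Gv by (auto intro!: ideal_prod_is_ideal ideal_conductor ideal_pideal)
  have J_sub: "J (pideal r f) \<subseteq> conductor r (pideal r (\<Prod>M))" if f: "f \<in> M" for f
  proof
    fix x assume "x \<in> J (pideal r f)"
    then have "x \<in> conductor r (pideal r f) \<cdot>\<^bsub>coord_ring r\<^esub> pideal r (\<Prod>(M - {f}))" using J[OF f] by simp
    then show "x \<in> conductor r (pideal r (\<Prod>M))"
    proof (induction x rule: ideal_prod.induct)
      case (prod h g)
      then have "h * g \<in> conductor r (pideal r (\<Prod>M))"
        using Gv by (intro component_conductor_times_complement[OF M(1,2) f]) (simp_all add: mem_pideal_iff)
      then show ?case by (simp add: coord_ring_def)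
    next
      case (sum x y)
      then show ?case using ideal_conductor[OF Pv]
        by (intro additive_subgroup.a_closed ideal.axioms(1))
    qed
  qed
  have "conductor r (pideal r (\<Prod>M)) = {s. \<exists>j. (\<forall>I \<in> pideal r ` M. j I \<in> J I) \<and> s = (\<Sum>I \<in> pideal r ` M. j I)}"
  proof (intro equalityI subsetI)
    fix s assume "s \<in> conductor r (pideal r (\<Prod>M))"
    then obtain h where h: "\<forall>f \<in> M. h f \<in> conductor r (pideal r f)" "s = (\<Sum>f \<in> M. h f * \<Prod>(M - {f}))"
      using conductor_subset_sum[OF M] by blast
    define j where "j I = (let f = the_inv_into M (pideal r) I in h f * \<Prod>(M - {f}))" for I
    have j: "j (pideal r f) = h f * \<Prod>(M - {f})" if "f \<in> M" for f
      using the_inv_into_f_f[OF pideal_inj[OF M(1,2)] that] by (simp add: j_def)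
    have "j (pideal r f) \<in> J (pideal r f)" if f: "f \<in> M" for f
    proof -
      have "h f \<otimes>\<^bsub>coord_ring r\<^esub> \<Prod>(M - {f}) \<in> J (pideal r f)"
        unfolding J[OF f] using h(1) f Gv by (intro ideal_prod.prod) (simp_all add: mem_pideal_iff)
      then show ?thesis unfolding j[OF f] by (simp add: coord_ring_def)
    qed
    moreover have "s = (\<Sum>I \<in> pideal r ` M. j I)"
      unfolding h(2) sum.reindex[OF pideal_inj[OF M(1,2)]] by (intro sum.cong) (simp_all add: j)
    ultimately show "s \<in> {s. \<exists>j. (\<forall>I \<in> pideal r ` M. j I \<in> J I) \<and> s = (\<Sum>I \<in> pideal r ` M. j I)}" by blast
  next
    fix s assume "s \<in> {s. \<exists>j. (\<forall>I \<in> pideal r ` M. j I \<in> J I) \<and> s = (\<Sum>I \<in> pideal r ` M. j I)}"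
    then obtain j where j: "\<forall>I \<in> pideal r ` M. j I \<in> J I" "s = (\<Sum>I \<in> pideal r ` M. j I)" by blast
    interpret C: ideal "conductor r (pideal r (\<Prod>M))" "coord_ring r" by (rule ideal_conductor[OF Pv])
    have "(\<Sum>I \<in> N. j I) \<in> conductor r (pideal r (\<Prod>M))" if "finite N" "N \<subseteq> pideal r ` M" for N
      using that
    proof (induction N)
      case empty
      then show ?case using C.zero_closed by (simp add: coord_ring_def)
    next
      case (insert I N)
      then obtain f where f: "f \<in> M" "I = pideal r f" by auto
      then have "j I \<in> conductor r (pideal r (\<Prod>M))" using subsetD[OF J_sub[OF f(1)]] j(1) by simp
      then show ?case using insert C.a_closed[of "j I" "\<Sum>I \<in> N. j I"] by (simp add: coord_ring_def)
    qed
    then show "s \<in> conductor r (pideal r (\<Prod>M))" using j(2) fin by simp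
  qed
  also have "\<dots> = (\<Oplus>\<^bsub>ideals_set (coord_ring r)\<^esub> I \<in> pideal r ` M. J I)"
    using fin J_ideal by (intro finsum_ideals[symmetric]) auto
  finally show ?thesis unfolding J_def .
qed

theorem proposition6p1:
  fixes r :: nat and IX :: "('k::field) poly_nat set"
  assumes "hypersurface r IX" and "reduced_subscheme r IX"
  shows "conductor r IX =
    (\<Oplus>\<^bsub>ideals_set (coord_ring r)\<^esub> IY \<in> component_subschemes r IX.
       conductor r IY \<cdot>\<^bsub>coord_ring r\<^esub>
       (\<Otimes>\<^bsub>ideals_set (coord_ring r)\<^esub> IZ \<in> component_subschemes r IX - {IY}. IZ))"
proof -
  obtain d F where d: "d \<ge> 1" and Fd: "F \<in> forms r d" and F0: "F \<noteq> 0" and IX: "IX = pideal r F"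
    using assms(1) unfolding hypersurface_def by blast
  have F: "F \<in> all_forms r" using Fd by (auto simp: all_forms_def)
  have Fv: "F \<in> vars (Suc r)" using F by (rule all_forms_vars)
  have sat: "saturated r (pideal r F)"
    using assms(1) IX by (simp add: hypersurface_def closed_subscheme_def)
  have "\<not> p * p dvd F" if "prime_elem p" for p
    using reduced_hypersurface_squarefree[OF F F0 _ that] assms(2) IX by simp
  then obtain M where M: "nonassociate_primes M" "F dvd \<Prod>M" "\<Prod>M dvd F"
    using squarefree_prime_factorization[OF F0] by blast
  have Mv: "M \<subseteq> vars (Suc r)"
  proof
    fix f assume "f \<in> M"
    then have "f dvd \<Prod>M" using M(1) by (auto simp: nonassociate_primes_def intro: dvd_prod_eqI)
    then show "f \<in> vars (Suc r)" using vars_factor[OF Fv F0] M(3) dvd_trans by blast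
  qed
  have "M \<noteq> {}"
  proof
    assume "M = {}"
    then have "F dvd 1" using M(2) by simp
    then have "total_deg F = 0" using total_deg_eq_0_iff[OF F0] by blast
    moreover have "total_deg F = d" using Fd F0 by (simp add: forms_iff_grading degree_monom_eq)
    ultimately show False using d by simp
  qed
  have Pv: "\<Prod>M \<in> vars (Suc r)" using Mv by (intro vars_prod) auto
  have "pideal r F = pideal r (\<Prod>M)"
    using M(2,3) dvd_trans by (auto simp: mem_pideal_iff Fv Pv)
  then have "conductor r IX = conductor r (pideal r (\<Prod>M))" using IX by simp
  also note conductor_prod_primes[OF M(1) Mv \<open>M \<noteq> {}\<close>]
  finally show ?thesis
    unfolding IX component_subschemes_hypersurface[OF F F0 sat M] .
qed

end
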